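(* Let $D=(E,\mathcal{F})$ be a binary delta-matroid and let $\bullet\in\{\ast,\times,\ast\times,\times\ast,\ast\times\ast\}$. Then the partial-$\bullet$ polynomial $$^{\partial}w_{D}^{\bullet}(z)=\sum_{A\subseteq E} z^{w(D^{\bullet|A})}$$ is either an even polynomial, an odd polynomial, or both even-interpolating and odd-interpolating.
   Context: A set system is a pair $D=(E,\mathcal{F})$ with $E$ a finite set and $\mathcal{F}\subseteq 2^E$ (the feasible sets); it is proper if $\mathcal{F}\neq\emptyset$. Write $X\triangle Y$ for symmetric difference. A delta-matroid is a proper set system such that for all $X,Y\in\mathcal{F}$ and $u\in X\triangle Y$ there is $v\in X\triangle Y$ (possibly $v=u$) with $X\triangle\{u,v\}\in\mathcal{F}$. Width: for a proper set system, $w(D)=\max_{F\in\mathcal{F}}|F|-\min_{F\in\mathcal{F}}|F|$. Twist: for $A\subseteq E$, $D^{\ast|A}=(E,\{X\triangle A\mid X\in\mathcal{F}\})$. Loop complementation: for $e\in E$, $D^{\times|e}=(E,\mathcal{F}\triangle\{F\cup\{e\}\mid F\in\mathcal{F},\ e\notin F\})$; loop complementations at different elements commute, so $D^{\times|A}$ is defined for $A\subseteq E$ by applying loop complementation once at each element of $A$. For a word $\bullet$ in $\ast,\times$ the operations are applied successively from left to right, e.g. $D^{\ast\times|A}=(D^{\ast|A})^{\times|A}$, $D^{\times\ast|A}=(D^{\times|A})^{\ast|A}$, $D^{\ast\times\ast|A}=((D^{\ast|A})^{\times|A})^{\ast|A}$. Binary: for a symmetric matrix $C$ over $\mathrm{GF}(2)$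 with rows and columns indexed by a finite set $E$, let $D(C)=(E,\{A\subseteq E\mid C[A]\text{ is nonsingular over }\mathrm{GF}(2)\})$, where $C[A]$ is the principal submatrix induced by $A$ and $C[\emptyset]$ is nonsingular by convention. A delta-matroid $D$ is binary if some twist $D^{\ast|A}$ of $D$ is isomorphic to $D(C)$ for some such $C$. Polynomials: $p(z)=\sum_{i=0}^n c_iz^i$ has a gap of size $k\ge 1$ at $c_i$ if $c_{i-1}c_{i+k}\ne0$ and $c_i=\dots=c_{i+k-1}=0$. It is interpolating if it is non-zero and has no gaps. Write $p(z)=p_e(z^2)+z\,p_o(z^2)$. Then $p$ is even-interpolating (resp. odd-interpolating) if $p_e$ (resp. $p_o$), regarded as a polynomial in the variable $t=z^2$, is interpolating. An even (resp. odd) polynomial is one whose non-zero coefficients occur only in even (resp. odd) degrees. *)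

theory Defs
  imports
    "HOL-Library.Z2"
    "HOL-Combinatorics.Permutations"
    "HOL-Computational_Algebra.Polynomial"
begin

type_synonym 'a setsys = "'a set \<times> 'a set set"

abbreviation ground :: "'a setsys \<Rightarrow> 'a set" where
  "ground D \<equiv> fst D"

abbreviation feasible :: "'a setsys \<Rightarrow> 'a set set" where
  "feasible D \<equiv> snd D"

definition set_system :: "'a setsys \<Rightarrow> bool" where
  "set_system D \<longleftrightarrow> finite (ground D) \<and> feasible D \<subseteq> Pow (ground D)"

definition proper :: "'a setsys \<Rightarrow> bool" where
  "proper D \<longleftrightarrow> feasible D \<noteq> {}"

definition delta_matroid :: "'a setsys \<Rightarrow> bool" where
  "delta_matroid D \<longleftrightarrow> set_system D \<and> proper D \<and>
     (\<forall>X\<in>feasible D. \<forall>Y\<in>feasible D. \<forall>u\<in>sym_diff X Y. \<exists>v\<in>sym_diff X Y.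
        sym_diff X {u, v} \<in> feasible D)"

text \<open>The subtraction on \<^typ>\<open>nat\<close> does not truncate when the system is proper, and twists and
  loop complementations of proper systems are proper.\<close>

definition width :: "'a setsys \<Rightarrow> nat" where
  "width D = Max (card ` feasible D) - Min (card ` feasible D)"

definition twist :: "'a set \<Rightarrow> 'a setsys \<Rightarrow> 'a setsys" where
  "twist A D = (ground D, (\<lambda>X. sym_diff X A) ` feasible D)"

definition loop_compl1 :: "'a \<Rightarrow> 'a setsys \<Rightarrow> 'a setsys" where
  "loop_compl1 e D = (ground D, sym_diff (feasible D) (insert e ` {X \<in> feasible D. e \<notin> X}))"

definition loop_compl :: "'a set \<Rightarrow> 'a setsys \<Rightarrow> 'a setsys" where
  "loop_compl A D = Finite_Set.fold loop_compl1 D A"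

text \<open>Loop complementations at single elements commute, so the fold over a finite set does not
  depend on the order in which the elements are processed.\<close>

lemma mem_feasible_loop_compl1:
  "Z \<in> feasible (loop_compl1 e D) \<longleftrightarrow> (Z \<in> feasible D) \<noteq> (e \<in> Z \<and> Z - {e} \<in> feasible D)"
proof -
  have "Z \<in> insert e ` {X \<in> feasible D. e \<notin> X} \<longleftrightarrow> e \<in> Z \<and> Z - {e} \<in> feasible D"
  proof
    assume "e \<in> Z \<and> Z - {e} \<in> feasible D"
    then show "Z \<in> insert e ` {X \<in> feasible D. e \<notin> X}"
      by (intro image_eqI[where x = "Z - {e}"]) auto
  qed auto
  then show ?thesis
    unfolding loop_compl1_def by auto
qed

lemma loop_compl1_commute:
  "loop_compl1 e (loop_compl1 f D) = loop_compl1 f (loop_compl1 e D)"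
proof (rule prod_eqI)
  show "feasible (loop_compl1 e (loop_compl1 f D)) = feasible (loop_compl1 f (loop_compl1 e D))"
  proof (rule set_eqI)
    fix Z
    have "Z - {e} - {f} = Z - {f} - {e}" by auto
    then show "Z \<in> feasible (loop_compl1 e (loop_compl1 f D)) \<longleftrightarrow>
        Z \<in> feasible (loop_compl1 f (loop_compl1 e D))"
      by (cases "e = f") (auto simp: mem_feasible_loop_compl1)
  qed
qed (simp add: loop_compl1_def)

lemma comp_fun_commute_loop_compl1: "comp_fun_commute loop_compl1"
  by unfold_locales (simp add: fun_eq_iff loop_compl1_commute)

lemma loop_compl_empty: "loop_compl {} D = D"
  by (simp add: loop_compl_def)

lemma loop_compl_insert:
  "finite A \<Longrightarrow> e \<notin> A \<Longrightarrow> loop_compl (insert e A) D = loop_compl1 e (loop_compl A D)"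
  unfolding loop_compl_def
  by (rule comp_fun_commute_on.fold_insert
      [OF comp_fun_commute_loop_compl1[unfolded comp_fun_commute_def']]) auto

datatype letter = Star | Times

primrec apply_letter :: "'a set \<Rightarrow> letter \<Rightarrow> 'a setsys \<Rightarrow> 'a setsys" where
  "apply_letter A Star D = twist A D"
| "apply_letter A Times D = loop_compl A D"

text \<open>The list \<^const>\<open>fold\<close> applies the letters of the word from left to right.\<close>

definition apply_word :: "letter list \<Rightarrow> 'a set \<Rightarrow> 'a setsys \<Rightarrow> 'a setsys" where
  "apply_word w A D = fold (apply_letter A) w D"

text \<open>The Leibniz determinant of the matrix \<open>(C i j)\<close> with \<open>i, j \<in> A\<close>, for a finite index set \<open>A\<close>;
  applied to a matrix indexed by a larger set, it is the determinant of the principal submatrix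
  induced by \<open>A\<close>. For empty \<open>A\<close> it is 1.\<close>

definition det_on :: "'a set \<Rightarrow> ('a \<Rightarrow> 'a \<Rightarrow> 'k::comm_ring_1) \<Rightarrow> 'k" where
  "det_on A C = (\<Sum>p | p permutes A. of_int (sign p) * (\<Prod>i\<in>A. C i (p i)))"

lemma det_on_empty: "det_on {} C = 1"
  by (simp add: det_on_def)

definition symmetric_on :: "'a set \<Rightarrow> ('a \<Rightarrow> 'a \<Rightarrow> 'k) \<Rightarrow> bool" where
  "symmetric_on E C \<longleftrightarrow> (\<forall>i\<in>E. \<forall>j\<in>E. C i j = C j i)"

definition matrix_setsys :: "'a set \<Rightarrow> ('a \<Rightarrow> 'a \<Rightarrow> bit) \<Rightarrow> 'a setsys" where
  "matrix_setsys E C = (E, {A. A \<subseteq> E \<and> det_on A C \<noteq> 0})"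

definition setsys_iso :: "'a setsys \<Rightarrow> 'b setsys \<Rightarrow> bool" where
  "setsys_iso D D' \<longleftrightarrow>
     (\<exists>f. bij_betw f (ground D) (ground D') \<and> feasible D' = (\<lambda>X. f ` X) ` feasible D)"

text \<open>An isomorphism preserves the size of the ground set, so it is no restriction that the index
  set \<open>E'\<close> of the matrix lives in the same type as the ground set of \<open>D\<close>.\<close>

definition binary_delta_matroid :: "'a setsys \<Rightarrow> bool" where
  "binary_delta_matroid D \<longleftrightarrow> delta_matroid D \<and>
     (\<exists>A E' C. A \<subseteq> ground D \<and> finite (E' :: 'a set) \<and> symmetric_on E' C \<and>
        setsys_iso (twist A D) (matrix_setsys E' C))"

definition partial_poly :: "letter list \<Rightarrow> 'a setsys \<Rightarrow> int poly" where
  "partial_poly w D = (\<Sum>A\<in>Pow (ground D). monom 1 (width (apply_word w A D)))"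

definition has_gap_at :: "'k::comm_semiring_1 poly \<Rightarrow> nat \<Rightarrow> nat \<Rightarrow> bool" where
  "has_gap_at p k i \<longleftrightarrow> k \<ge> 1 \<and> i \<ge> 1 \<and> coeff p (i - 1) * coeff p (i + k) \<noteq> 0 \<and>
     (\<forall>j\<in>{i..<i + k}. coeff p j = 0)"

definition interpolating :: "'k::comm_semiring_1 poly \<Rightarrow> bool" where
  "interpolating p \<longleftrightarrow> p \<noteq> 0 \<and> \<not> (\<exists>k i. has_gap_at p k i)"

text \<open>The polynomials \<open>p\<^sub>e\<close> and \<open>p\<^sub>o\<close> with \<open>p(z) = p\<^sub>e(z^2) + z p\<^sub>o(z^2)\<close>.\<close>

definition even_part :: "'k::comm_semiring_1 poly \<Rightarrow> 'k poly" where
  "even_part p = (\<Sum>i\<le>degree p. monom (coeff p (2 * i)) i)"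

definition odd_part :: "'k::comm_semiring_1 poly \<Rightarrow> 'k poly" where
  "odd_part p = (\<Sum>i\<le>degree p. monom (coeff p (2 * i + 1)) i)"

lemma coeff_even_part: "coeff (even_part p) n = coeff p (2 * n)"
  by (auto simp: even_part_def coeff_sum coeff_eq_0)

lemma coeff_odd_part: "coeff (odd_part p) n = coeff p (2 * n + 1)"
  by (auto simp: odd_part_def coeff_sum coeff_eq_0)

definition even_interpolating :: "'k::comm_semiring_1 poly \<Rightarrow> bool" where
  "even_interpolating p \<longleftrightarrow> interpolating (even_part p)"

definition odd_interpolating :: "'k::comm_semiring_1 poly \<Rightarrow> bool" where
  "odd_interpolating p \<longleftrightarrow> interpolating (odd_part p)"

definition even_poly :: "'k::zero poly \<Rightarrow> bool" where
  "even_poly p \<longleftrightarrow> (\<forall>n. coeff p n \<noteq> 0 \<longrightarrow> even n)"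

definition odd_poly :: "'k::zero poly \<Rightarrow> bool" where
  "odd_poly p \<longleftrightarrow> (\<forall>n. coeff p n \<noteq> 0 \<longrightarrow> odd n)"

end

theory Submission
  imports Defs "Jordan_Normal_Form.Determinant"
begin

text \<open>
  The width of a set system on \<open>E\<close> is \<open>card E\<close> minus two defects: the size of a smallest feasible
  set, and the size of a smallest feasible set of the twist by all of \<open>E\<close>. For the words \<open>*\<close>,
  \<open>*\<times>\<close> and \<open>\<times>*\<close>, each of the two defects of the system obtained at \<open>A\<close> is the
  distance from \<open>A\<close> to the feasible sets of one fixed system, which arises from \<open>D\<close> by twists and
  loop complementations on the whole of \<open>E\<close> (\<open>width_Star\<close>, \<open>width_Star_Times\<close>,
  \<open>width_Times_Star\<close>). The reason is that loop complementation does not change the size of a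
  smallest feasible set, so that it may be applied last at elements of our choice. For \<open>\<times>\<close> and
  \<open>*\<times>*\<close> one defect is constant and the width moves by at most 1 when one element is added to \<open>A\<close>,
  so every number between two widths is a width.

  What remains is a statement on the sum \<open>f\<close> of the distances to two binary families
  (\<open>no_parity_gap\<close>): if \<open>f P < c < f Q\<close>, with all three numbers of one parity, then \<open>c\<close> is a
  value of \<open>f\<close>. In a counterexample with \<open>E\<close> as small as possible, \<open>P\<close> and \<open>Q\<close> are complementary
  and every other set has a value of the other parity, because a third set with the parity of \<open>c\<close>
  would form a counterexample together with \<open>P\<close> or \<open>Q\<close> after the deletion of an element. Twisting
  by \<open>Q\<close>, let \<open>Q = {}\<close> and \<open>P = E\<close>, so that \<open>f E \<le> f {} - 4\<close>. A rule on the four corners of a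
  square (\<open>dist_to_square\<close>) excludes that both distances are positive at the empty set. So one of
  them vanishes there, which means that its family consists of the nonsingular principal index
  sets of a symmetric matrix \<open>C\<close>. Let \<open>B\<close> be a member of the other family that is nearest to the
  empty set; it has at least four elements. The parity of \<open>f\<close> at sets with at most three elements
  forces all columns of \<open>C\<close> with index in \<open>B\<close> to be equal. Hence a nonsingular index set has at
  most one element in \<open>B\<close>, its distance from \<open>E\<close> is at least \<open>card B - 1\<close>, and this is too large
  for \<open>f E \<le> f {} - 4 = card B - 4\<close>.

  That the systems in question are binary is seen in the symplectic space of pairs \<open>(u, v)\<close> of
  vectors over GF(2). A symmetric matrix \<open>C\<close> gives the Lagrangian space of all \<open>(C v, v)\<close>, and the
  feasible sets correspond to coordinate subspaces that meet it trivially. A twist exchanges \<open>u\<close>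
  and \<open>v\<close> at some coordinates, a loop complementation adds \<open>v\<close> to \<open>u\<close>, and both preserve Lagrangian
  spaces. Whenever the empty set is feasible, the space is the graph of a symmetric matrix again.
\<close>

(* Keeps sums and products over GF(2) in field notation, so that the laws of fields apply. *)
declare add_bit_eq_xor [simp del] mult_bit_eq_and [simp del]

section \<open>Nonsingular principal submatrices over GF(2)\<close>

text \<open>The kernel criterion in place of the determinant: vectors are functions that vanish outside of
  the index set, so that the index set can vary without a change of type.\<close>

definition nonsing :: "('a \<Rightarrow> 'a \<Rightarrow> bit) \<Rightarrow> 'a set \<Rightarrow> bool" where
  "nonsing C A \<longleftrightarrow>
     (\<forall>v. (\<forall>i. i \<notin> A \<longrightarrow> v i = 0) \<longrightarrow> (\<forall>i\<in>A. (\<Sum>j\<in>A. C i j * v j) = 0) \<longrightarrow> (\<forall>i. v i = 0))"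

lemma nonsingD:
  assumes "nonsing C A" "\<And>i. i \<notin> A \<Longrightarrow> v i = 0" "\<And>i. i \<in> A \<Longrightarrow> (\<Sum>j\<in>A. C i j * v j) = 0"
  shows "v i = 0"
  using assms unfolding nonsing_def by blast

lemma nonsing_singleton: "nonsing C {e} \<longleftrightarrow> C e e = 1"
proof
  assume n: "nonsing C {e}"
  show "C e e = 1"
  proof (rule ccontr)
    assume "C e e \<noteq> 1"
    then have "(if e = e then 1 else 0 :: bit) = 0"
      by - (rule nonsingD[OF n, where v = "\<lambda>i. if i = e then 1 else 0"], auto)
    then show False by simp
  qed
qed (auto simp: nonsing_def)

lemma nonsing_pair:
  assumes "e \<noteq> f" "C f e = C e f"
  shows "nonsing C {e, f} \<longleftrightarrow> C e e * C f f \<noteq> C e f"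
proof
  assume n: "nonsing C {e, f}"
  have *: "a = 0 \<and> b = 0" if "C e e * a + C e f * b = 0" "C e f * a + C f f * b = 0" for a b
  proof -
    have "(if i = e then a else if i = f then b else 0) = 0" for i
      using assms that
      by - (rule nonsingD[OF n, where v = "\<lambda>i. if i = e then a else if i = f then b else 0"],
          auto split: if_splits)
    from this[of e] this[of f] show ?thesis using assms(1) by simp
  qed
  show "C e e * C f f \<noteq> C e f"
    using *[of 0 1] *[of 1 0] *[of 1 1]
    by (cases "C e e"; cases "C f f"; cases "C e f") auto
next
  assume n: "C e e * C f f \<noteq> C e f"
  show "nonsing C {e, f}"
    unfolding nonsing_def
  proof (intro allI impI)
    fix v i
    assume z: "\<forall>i. i \<notin> {e, f} \<longrightarrow> v i = 0"
      and k: "\<forall>i\<in>{e, f}. (\<Sum>j\<in>{e, f}. C i j * v j) = 0"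
    have "C e e * v e + C e f * v f = 0" "C e f * v e + C f f * v f = 0"
      using k assms by auto
    then have "v e = 0 \<and> v f = 0"
      using n by (cases "C e e"; cases "C f f"; cases "C e f"; cases "v e"; cases "v f") auto
    then show "v i = 0" using z by (cases "i = e"; cases "i = f") auto
  qed
qed

text \<open>Together with the tests for one and two indices, this shape decides all submatrices that occur
  in the comparison of two columns in \<open>no_antipodal_jump_at_member\<close>.\<close>

lemma nonsing_triple:
  assumes "e \<noteq> g" "e \<noteq> f" "g \<noteq> f"
    and "C e e = 1" "C g g = 1" "C e g = 1" "C g e = 1" "C e f = 1" "C f e = 1" "C g f = 0" "C f g = 0"
  shows "nonsing C {e, g, f}"
  unfolding nonsing_def
proof (intro allI impI)
  fix v i
  assume z: "\<forall>i. i \<notin> {e, g, f} \<longrightarrow> v i = 0"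
    and k: "\<forall>i\<in>{e, g, f}. (\<Sum>j\<in>{e, g, f}. C i j * v j) = 0"
  have "v e + (v g + v f) = 0" "v e + v g = 0" "v e + C f f * v f = 0"
    using k assms by auto
  then have "v e = 0 \<and> v f = 0 \<and> v g = 0"
    by (cases "v e"; cases "v f"; cases "v g") auto
  then show "v i = 0" using z by (cases "i = e"; cases "i = f"; cases "i = g") auto
qed

lemma not_nonsing_equal_columns:
  assumes "finite X" "e \<in> X" "g \<in> X" "e \<noteq> g" "\<And>i. i \<in> X \<Longrightarrow> C i e = C i g"
  shows "\<not> nonsing C X"
proof
  assume n: "nonsing C X"
  let ?v = "\<lambda>i. if i = e \<or> i = g then 1 else 0 :: bit"
  have "(\<Sum>j\<in>X. C i j * ?v j) = 0" if "i \<in> X" for i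
  proof -
    have "(\<Sum>j\<in>X. C i j * ?v j) = (\<Sum>j\<in>{e, g}. C i j * ?v j)"
      using assms by (intro sum.mono_neutral_right) auto
    also have "\<dots> = 0" using assms(4) assms(5)[OF that] by simp
    finally show ?thesis .
  qed
  then have "?v e = 0" using assms by - (rule nonsingD[OF n, where v = ?v], auto)
  then show False by simp
qed

lemma nonsing_reindex_imp:
  assumes f: "bij_betw f X Y" and eq: "\<And>i j. i \<in> X \<Longrightarrow> j \<in> X \<Longrightarrow> C' i j = C (f i) (f j)"
    and n: "nonsing C Y"
  shows "nonsing C' X"
  unfolding nonsing_def
proof (intro allI impI)
  fix v i assume v: "\<forall>i. i \<notin> X \<longrightarrow> v i = 0" "\<forall>i\<in>X. (\<Sum>j\<in>X. C' i j * v j) = 0"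
  define u where "u y = (if y \<in> Y then v (inv_into X f y) else 0)" for y
  have uf: "u (f j) = v j" if "j \<in> X" for j
    using that f by (simp add: u_def bij_betw_inv_into_left bij_betw_apply)
  have "(\<Sum>z\<in>Y. C y z * u z) = 0" if y: "y \<in> Y" for y
  proof -
    obtain i where i: "i \<in> X" "y = f i" 
      using y bij_betw_imp_surj_on[OF f] by auto
    have "(\<Sum>z\<in>Y. C y z * u z) = (\<Sum>j\<in>X. C y (f j) * u (f j))"
      using sum.reindex_bij_betw[OF f, of "\<lambda>z. C y z * u z"] by simp
    also have "\<dots> = (\<Sum>j\<in>X. C' i j * v j)"
      by (intro sum.cong refl) (use i uf eq in simp)
    finally show ?thesis using v(2) i(1) by simp
  qed
  then have u0: "u y = 0" for y
    by - (rule nonsingD[OF n, where v = u], auto simp: u_def)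
  show "v i = 0" using v(1) uf[of i] u0[of "f i"] by (cases "i \<in> X") auto
qed

lemma nonsing_reindex:
  assumes f: "bij_betw f X Y" and eq: "\<And>i j. i \<in> X \<Longrightarrow> j \<in> X \<Longrightarrow> C' i j = C (f i) (f j)"
  shows "nonsing C' X \<longleftrightarrow> nonsing C Y"
proof
  show "nonsing C Y \<Longrightarrow> nonsing C' X" using nonsing_reindex_imp[OF f] eq by blast
  assume "nonsing C' X"
  then show "nonsing C Y"
  proof (rule nonsing_reindex_imp[OF bij_betw_inv_into[OF f], rotated])
    fix i j assume "i \<in> Y" "j \<in> Y"
    then show "C i j = C' (inv_into X f i) (inv_into X f j)"
      using f eq[of "inv_into X f i" "inv_into X f j"]
      by (simp add: bij_betw_inv_into_right bij_betw_imp_surj_on inv_into_into)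
  qed
qed

lemma sign_bit: "of_int (sign p) = (1 :: bit)"
  by (simp add: sign_def)

text \<open>Signs do not matter over GF(2), so conjugating permutations by the bijection is enough. This
  carries the determinant to the index set \<open>{0..<n}\<close> of a matrix.\<close>

lemma det_on_bit_reindex:
  fixes C :: "'b \<Rightarrow> 'b \<Rightarrow> bit"
  assumes h: "bij_betw h X Y"
  shows "det_on Y C = det_on X (\<lambda>i j. C (h i) (h j))"
proof -
  let ?g = "\<lambda>\<pi> x. if x \<in> Y then h (\<pi> (inv_into X h x)) else x"
  have "det_on Y C = (\<Sum>p | p permutes Y. \<Prod>i\<in>Y. C i (p i))"
    by (simp only: det_on_def sign_bit mult_1)
  also have "\<dots> = (\<Sum>p | p permutes X. \<Prod>i\<in>Y. C i (?g p i))"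
    using sum.reindex_bij_betw[OF bij_betw_permutations[OF h], of "\<lambda>p. \<Prod>i\<in>Y. C i (p i)"] by (rule sym)
  also have "\<dots> = (\<Sum>p | p permutes X. \<Prod>i\<in>X. C (h i) (h (p i)))"
  proof (intro sum.cong refl)
    fix p
    have "(\<Prod>i\<in>Y. C i (?g p i)) = (\<Prod>i\<in>X. C (h i) (?g p (h i)))"
      using prod.reindex_bij_betw[OF h, of "\<lambda>i. C i (?g p i)"] by simp
    also have "\<dots> = (\<Prod>i\<in>X. C (h i) (h (p i)))"
      using h by (intro prod.cong refl) (simp add: bij_betw_inv_into_left bij_betw_apply)
    finally show "(\<Prod>i\<in>Y. C i (?g p i)) = (\<Prod>i\<in>X. C (h i) (h (p i)))" .
  qed
  finally show ?thesis by (simp only: det_on_def sign_bit mult_1)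
qed

lemma det_on_interval_iff_nonsing:
  fixes C :: "nat \<Rightarrow> nat \<Rightarrow> bit"
  shows "det_on {0..<n} C \<noteq> 0 \<longleftrightarrow> nonsing C {0..<n}"
proof -
  define M where "M = mat n n (\<lambda>(i, j). C i j)"
  have M: "M \<in> carrier_mat n n" by (simp add: M_def)
  have "det_on {0..<n} C = det M"
    unfolding det_def'[OF M] det_on_def sign_bit mult_1
    by (intro sum.cong refl prod.cong) (auto simp: M_def permutes_in_image)
  then have det: "det_on {0..<n} C = 0 \<longleftrightarrow> (\<exists>v. v \<in> carrier_vec n \<and> v \<noteq> 0\<^sub>v n \<and> M *\<^sub>v v = 0\<^sub>v n)"
    using det_0_iff_vec_prod_zero[OF M] by simp
  have app: "(M *\<^sub>v v) $ i = (\<Sum>j\<in>{0..<n}. C i j * v $ j)" if "v \<in> carrier_vec n" "i < n" for v i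
    using that by (simp add: M_def scalar_prod_def)
  show ?thesis
  proof
    assume d: "det_on {0..<n} C \<noteq> 0"
    show "nonsing C {0..<n}"
      unfolding nonsing_def
    proof (intro allI impI)
      fix v i assume v: "\<forall>i. i \<notin> {0..<n} \<longrightarrow> v i = 0" "\<forall>i\<in>{0..<n}. (\<Sum>j\<in>{0..<n}. C i j * v j) = 0"
      have "M *\<^sub>v vec n v = 0\<^sub>v n"
        using v(2) app[of "vec n v"] by (intro eq_vecI) (auto simp: M_def)
      then have "vec n v = 0\<^sub>v n" using d det vec_carrier by blast
      then show "v i = 0"
        using v(1) by (cases "i < n") (auto dest: arg_cong[where f = "\<lambda>x. x $ i"])
    qed
  next
    assume n: "nonsing C {0..<n}"
    show "det_on {0..<n} C \<noteq> 0"
    proof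
      assume "det_on {0..<n} C = 0"
      then obtain v where v: "v \<in> carrier_vec n" "v \<noteq> 0\<^sub>v n" "M *\<^sub>v v = 0\<^sub>v n" using det by blast
      have "(if i < n then v $ i else 0) = 0" for i
      proof (rule nonsingD[OF n, where v = "\<lambda>i. if i < n then v $ i else 0"])
        fix i assume "i \<in> {0..<n}"
        then show "(\<Sum>j\<in>{0..<n}. C i j * (if j < n then v $ j else 0)) = 0"
          using app[OF v(1), of i] v(3) by simp
      qed simp
      then have "v = 0\<^sub>v n" using v(1) by (intro eq_vecI) (auto, metis)
      then show False using v(2) by simp
    qed
  qed
qed

lemma det_on_iff_nonsing:
  fixes C :: "'b \<Rightarrow> 'b \<Rightarrow> bit"
  assumes "finite A"
  shows "det_on A C \<noteq> 0 \<longleftrightarrow> nonsing C A"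
proof -
  obtain h where h: "bij_betw h {0..<card A} A" using ex_bij_betw_nat_finite[OF assms] by blast
  show ?thesis
    using det_on_interval_iff_nonsing[of "card A" "\<lambda>i j. C (h i) (h j)"] det_on_bit_reindex[OF h, of C]
      nonsing_reindex[OF h, of "\<lambda>i j. C (h i) (h j)" C] by simp
qed

section \<open>Binary families and the distance to them\<close>

text \<open>The condition ranges over all members \<open>Q\<close>, although a symmetric matrix for one of them yields a
  matrix for every other by principal pivoting. With this form the property passes to twists and
  deletions immediately, and the pivots are hidden in \<open>transversal_family_binary\<close>.\<close>

definition binary_family :: "'a set \<Rightarrow> 'a set set \<Rightarrow> bool" where
  "binary_family E F \<longleftrightarrow> finite E \<and> F \<subseteq> Pow E \<and> F \<noteq> {} \<and>
     (\<forall>Q\<in>F. \<exists>C. (\<forall>i j. C i j = C j i) \<and> (\<forall>X. X \<subseteq> E \<longrightarrow> (sym_diff X Q \<in> F \<longleftrightarrow> nonsing C X)))"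

lemma binary_familyE:
  assumes "binary_family E F" "Q \<in> F"
  obtains C where "\<And>i j. C i j = C j i" "\<And>X. X \<subseteq> E \<Longrightarrow> sym_diff X Q \<in> F \<longleftrightarrow> nonsing C X"
  using assms unfolding binary_family_def by metis

text \<open>Seen from \<open>X\<close>, the set \<open>Y\<close> is a nonsingular index set \<open>W\<close> that contains \<open>u\<close>. The row of \<open>u\<close> in \<open>C[W]\<close>
  is not zero, and a nonzero entry in it gives a nonsingular submatrix on one or two indices.\<close>

lemma binary_family_exchange:
  assumes F: "binary_family E F" and X: "X \<in> F" and Y: "Y \<in> F" and u: "u \<in> sym_diff X Y"
  shows "\<exists>v\<in>sym_diff X Y. sym_diff X {u, v} \<in> F"
proof -
  obtain C where sym: "\<And>i j. C i j = C j i"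
    and C: "\<And>Z. Z \<subseteq> E \<Longrightarrow> sym_diff Z X \<in> F \<longleftrightarrow> nonsing C Z"
    by (rule binary_familyE[OF F X]) (rule that)
  have sub: "X \<subseteq> E" "Y \<subseteq> E" and fin: "finite E" using F X Y by (auto simp: binary_family_def)
  let ?W = "sym_diff X Y"
  have W: "?W \<subseteq> E" "finite ?W" using sub fin by (auto intro: finite_subset)
  have "sym_diff ?W X = Y" by auto
  then have nW: "nonsing C ?W" using C[OF W(1)] Y by simp
  show ?thesis
  proof (cases "C u u = 1")
    case True
    then have "sym_diff {u} X \<in> F" using C[of "{u}"] u W by (auto simp: nonsing_singleton)
    moreover have "sym_diff {u} X = sym_diff X {u, u}" by auto
    ultimately show ?thesis using u by metis
  next
    case False
    have "\<exists>v\<in>?W. C u v = 1"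
    proof (rule ccontr)
      assume "\<not> (\<exists>v\<in>?W. C u v = 1)"
      then have z: "C i u = 0" if "i \<in> ?W" for i using that sym[of i u] by auto
      have "(\<Sum>j\<in>?W. C i j * (if j = u then 1 else 0)) = 0" if "i \<in> ?W" for i
        using W u z[OF that] by (intro sum.neutral) auto
      then have "(if u = u then 1 else 0 :: bit) = 0"
        using u by - (rule nonsingD[OF nW, where v = "\<lambda>j. if j = u then 1 else 0"], auto)
      then show False by simp
    qed
    then obtain v where v: "v \<in> ?W" "C u v = 1" by auto
    with False have "u \<noteq> v" by auto
    then have "nonsing C {u, v}" using sym v False by (subst nonsing_pair) auto
    moreover have "{u, v} \<subseteq> E" using u v W by blast
    ultimately have "sym_diff {u, v} X \<in> F" using C by blast
    moreover have "sym_diff {u, v} X = sym_diff X {u, v}" by auto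
    ultimately show ?thesis using v by metis
  qed
qed

text \<open>For the family of a symmetric matrix \<open>C\<close>, this is the nullity of \<open>C[A]\<close>.\<close>

definition dist_to :: "'a set set \<Rightarrow> 'a set \<Rightarrow> nat" where
  "dist_to F A = Min ((\<lambda>X. card (sym_diff A X)) ` F)"

lemma dist_to_le: "finite F \<Longrightarrow> X \<in> F \<Longrightarrow> dist_to F A \<le> card (sym_diff A X)"
  by (simp add: dist_to_def)

lemma dist_to_attained:
  assumes "finite F" "F \<noteq> {}"
  obtains X where "X \<in> F" "dist_to F A = card (sym_diff A X)"
proof -
  have "dist_to F A \<in> (\<lambda>X. card (sym_diff A X)) ` F"
    unfolding dist_to_def using assms by (intro Min_in) auto
  then show thesis using that by blast
qed

lemma binary_family_finite:
  assumes "binary_family E F"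
  shows "finite F" "F \<noteq> {}" "finite E" "\<And>X. X \<in> F \<Longrightarrow> X \<subseteq> E" "\<And>X. X \<in> F \<Longrightarrow> finite X"
proof -
  show F: "F \<noteq> {}" "finite E" "\<And>X. X \<in> F \<Longrightarrow> X \<subseteq> E"
    using assms by (auto simp: binary_family_def)
  then show "finite F" by (intro finite_subset[of F "Pow E"]) auto
  show "\<And>X. X \<in> F \<Longrightarrow> finite X" using F(2,3) by (metis finite_subset)
qed

lemma card_sym_diff_triangle:
  assumes "finite A" "finite B" "finite C"
  shows "card (sym_diff A C) \<le> card (sym_diff A B) + card (sym_diff B C)"
proof -
  have "sym_diff A C \<subseteq> sym_diff A B \<union> sym_diff B C" by blast
  then have "card (sym_diff A C) \<le> card (sym_diff A B \<union> sym_diff B C)"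
    using assms by (intro card_mono) auto
  also have "\<dots> \<le> card (sym_diff A B) + card (sym_diff B C)" by (rule card_Un_le)
  finally show ?thesis .
qed

lemma dist_to_Lipschitz:
  assumes F: "binary_family E F" and fin: "finite A" "finite B"
  shows "dist_to F A \<le> dist_to F B + card (sym_diff A B)"
proof -
  note finF = binary_family_finite[OF F]
  obtain X where X: "X \<in> F" "dist_to F B = card (sym_diff B X)"
    by (rule dist_to_attained[OF finF(1,2)]) (rule that)
  have "dist_to F A \<le> card (sym_diff A X)" using dist_to_le[OF finF(1) X(1)] .
  also have "\<dots> \<le> card (sym_diff A B) + card (sym_diff B X)"
    using fin finF(5)[OF X(1)] by (rule card_sym_diff_triangle)
  finally show ?thesis using X(2) by simp
qed

lemma dist_to_toggle:
  assumes F: "binary_family E F" and fin: "finite A"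
  shows "dist_to F (sym_diff A {e}) \<le> dist_to F A + 1" "dist_to F A \<le> dist_to F (sym_diff A {e}) + 1"
proof -
  have "sym_diff (sym_diff A {e}) A = {e}" "sym_diff A (sym_diff A {e}) = {e}" by blast+
  then show "dist_to F (sym_diff A {e}) \<le> dist_to F A + 1" "dist_to F A \<le> dist_to F (sym_diff A {e}) + 1"
    using dist_to_Lipschitz[OF F, of "sym_diff A {e}" A] dist_to_Lipschitz[OF F, of A "sym_diff A {e}"] fin
    by (simp_all only: finite_Un finite_Diff finite.intros simp_thms card.insert) simp_all
qed

lemma dist_to_twist: "dist_to ((\<lambda>X. sym_diff X Q) ` F) A = dist_to F (sym_diff A Q)"
proof -
  have "sym_diff A (sym_diff X Q) = sym_diff (sym_diff A Q) X" for X by blast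
  then show ?thesis unfolding dist_to_def image_image by (simp only:)
qed

lemma mem_twist: "X \<in> (\<lambda>X. sym_diff X Q) ` F \<longleftrightarrow> sym_diff X Q \<in> F"
proof
  assume "X \<in> (\<lambda>X. sym_diff X Q) ` F"
  then obtain Y where Y: "Y \<in> F" "X = sym_diff Y Q" ..
  have "sym_diff (sym_diff Y Q) Q = Y" by blast
  then show "sym_diff X Q \<in> F" unfolding Y(2) using Y(1) by (rule ssubst)
next
  assume "sym_diff X Q \<in> F"
  moreover have "X = sym_diff (sym_diff X Q) Q" by blast
  ultimately show " X \<in> (\<lambda>X. sym_diff X Q) ` F" by (rule rev_image_eqI)
qed

lemma binary_family_twist:
  assumes F: "binary_family E F" and Q: "Q \<subseteq> E"
  shows "binary_family E ((\<lambda>X. sym_diff X Q) ` F)" (is "binary_family E ?F")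
  unfolding binary_family_def
proof (intro conjI ballI)
  show "finite E" "?F \<noteq> {}" using F by (auto simp: binary_family_def)
  show "?F \<subseteq> Pow E" using F Q by (auto simp: binary_family_def)
  fix R assume "R \<in> ?F"
  then have RQ: "sym_diff R Q \<in> F" by (simp only: mem_twist)
  obtain C where C: "\<And>i j. C i j = C j i"
    "\<And>X. X \<subseteq> E \<Longrightarrow> sym_diff X (sym_diff R Q) \<in> F \<longleftrightarrow> nonsing C X"
    by (rule binary_familyE[OF F RQ]) (rule that)
  show "\<exists>C. (\<forall>i j. C i j = C j i) \<and> (\<forall>X. X \<subseteq> E \<longrightarrow> (sym_diff X R \<in> ?F \<longleftrightarrow> nonsing C X))"
  proof (intro exI[of _ C] conjI allI impI)
    fix X assume "X \<subseteq> E"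
    have "sym_diff (sym_diff X R) Q = sym_diff X (sym_diff R Q)" by blast
    then show "sym_diff X R \<in> ?F \<longleftrightarrow> nonsing C X"
      using C(2)[OF \<open>X \<subseteq> E\<close>] by (simp only: mem_twist)
  qed (rule C(1))
qed

text \<open>Among the members nearest to \<open>A\<close>, take one that differs from \<open>Q\<close> least outside of \<open>sym_diff A Q\<close>.
  An exchange towards \<open>Q\<close> at such a difference would either come nearer to \<open>A\<close> or keep the distance
  and remove the difference.\<close>

lemma nearest_member_between:
  assumes F: "binary_family E F" and "Q \<in> F" and A: "A \<subseteq> E"
  obtains Y where "Y \<in> F" "dist_to F A = card (sym_diff A Y)" "sym_diff Y Q \<subseteq> sym_diff A Q"
proof -
  note fin = binary_family_finite[OF F]
  have finA: "finite A" using A fin(3) by (rule finite_subset)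
  define N where "N = {Y \<in> F. dist_to F A = card (sym_diff A Y)}"
  obtain Y0 where "Y0 \<in> F" "dist_to F A = card (sym_diff A Y0)"
    by (rule dist_to_attained[OF fin(1,2)]) (rule that)
  then have Y0: "Y0 \<in> N" by (simp add: N_def)
  obtain Y where Y: "Y \<in> N" 
    and min: "\<And>Z. Z \<in> N \<Longrightarrow> card (sym_diff Y Q - sym_diff A Q) \<le> card (sym_diff Z Q - sym_diff A Q)"
    using ex_has_least_nat[of "\<lambda>Y. Y \<in> N" Y0 "\<lambda>Y. card (sym_diff Y Q - sym_diff A Q)", OF Y0] by blast
  have YF: "Y \<in> F" and Yd: "dist_to F A = card (sym_diff A Y)" using Y by (auto simp: N_def)
  have finY: "finite Y" "finite Q" using fin YF assms by auto
  have "sym_diff Y Q \<subseteq> sym_diff A Q"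
  proof (rule ccontr)
    assume "\<not> ?thesis"
    then obtain u where u: "u \<in> sym_diff Y Q" "u \<notin> sym_diff A Q" by blast
    obtain v where v: "v \<in> sym_diff Y Q" "sym_diff Y {u, v} \<in> F"
      using binary_family_exchange[OF F YF \<open>Q \<in> F\<close> u(1)] by blast
    have uAY: "u \<in> sym_diff A Y" using u by blast
    have le: "dist_to F A \<le> card (sym_diff A (sym_diff Y {u, v}))"
      using dist_to_le[OF fin(1) v(2)] .
    show False
    proof (cases "v = u \<or> v \<in> sym_diff A Y")
      case True
      then have "sym_diff A (sym_diff Y {u, v}) = sym_diff A Y - {u, v}" using uAY by blast
      moreover have "card (sym_diff A Y - {u, v}) < card (sym_diff A Y)"
        using uAY finA finY by (intro psubset_card_mono) blast+
      ultimately show False using le Yd by simp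
    next
      case False
      then have "v \<noteq> u" by blast
      have "sym_diff A (sym_diff Y {u, v}) = insert v (sym_diff A Y - {u})" using uAY False by blast
      moreover have "card (insert v (W - {u})) = card W" if "finite W" "u \<in> W" "v \<notin> W" for W
        using that card_Suc_Diff1[of W u] by simp
      ultimately have "card (sym_diff A (sym_diff Y {u, v})) = card (sym_diff A Y)"
        using uAY False finA finY by (metis finite_Diff finite_UnI)
      then have "sym_diff Y {u, v} \<in> N" using v Yd by (simp add: N_def)
      then have "card (sym_diff Y Q - sym_diff A Q)
          \<le> card (sym_diff (sym_diff Y {u, v}) Q - sym_diff A Q)"
        by (rule min)
      also have "\<dots> < card (sym_diff Y Q - sym_diff A Q)"
        using u v finA finY by (intro psubset_card_mono) blast+
      finally show False by simp
    qed
  qed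
  then show thesis using that YF Yd by blast
qed

text \<open>Write \<open>A + e\<close> for \<open>A\<close> with \<open>e\<close> toggled. Let \<open>Q\<close> be a member nearest to \<open>A + e\<close> and see everything
  from \<open>Q\<close>: then \<open>A + e\<close> becomes a set \<open>S\<close> with \<open>k - 1\<close> elements, and the other three corners
  \<open>A\<close>, \<open>A + f\<close> and \<open>A + e + f\<close> become \<open>S + e\<close>, \<open>S + e + f\<close> and \<open>S + f\<close>. Suppose that the last one
  also had distance \<open>k\<close>. Corners at distance \<open>k\<close> have at least \<open>k\<close> elements, so neither \<open>e\<close> nor
  \<open>f\<close> is in \<open>S\<close>, and a nearest member to \<open>S + e + f\<close> can be taken to be a singleton inside it.
  This singleton lies in \<open>S + e\<close> or in \<open>S + f\<close>, and that set would be at distance below \<open>k\<close>.\<close>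

lemma dist_to_square:
  assumes F: "binary_family E F" and A: "A \<subseteq> E" "e \<in> E" "f \<in> E" "e \<noteq> f"
    and de: "dist_to F (sym_diff A {e}) + 1 = k" and d: "dist_to F A = k"
    and df: "dist_to F (sym_diff A {f}) = k"
  shows "dist_to F (sym_diff (sym_diff A {e}) {f}) + 1 = k"
proof (rule ccontr)
  assume neg: "\<not> ?thesis"
  note fin = binary_family_finite[OF F]
  have finA: "finite A" using A(1) fin(3) by (rule finite_subset)
  let ?d = "dist_to F (sym_diff (sym_diff A {e}) {f})"
  have sw: "sym_diff (sym_diff A {e}) {f} = sym_diff (sym_diff A {f}) {e}" by blast
  have "?d \<le> k" using dist_to_toggle(1)[OF F, of "sym_diff A {e}" f] de finA by simp
  moreover have "k \<le> ?d + 1" using dist_to_toggle(2)[OF F, of "sym_diff A {f}" e] df finA sw by simp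
  ultimately have dk: "?d = k" using neg by simp
  obtain Q where Q: "Q \<in> F" "dist_to F (sym_diff A {e}) = card (sym_diff (sym_diff A {e}) Q)"
    by (rule dist_to_attained[OF fin(1,2)]) (rule that)
  have finQ: "finite Q" using fin Q by auto
  define S where "S = sym_diff (sym_diff A {e}) Q"
  have finS: "finite S" using finA finQ by (simp add: S_def)
  have cS: "card S + 1 = k" using Q de by (simp add: S_def)
  have le: "dist_to F B \<le> card (sym_diff B Y)" if "Y \<in> F" for B Y
    using dist_to_le[OF fin(1) that] .
  have AQ: "sym_diff A Q = sym_diff S {e}" unfolding S_def by blast
  have eS: "e \<notin> S"
  proof
    assume "e \<in> S"
    then have "card (sym_diff S {e}) < card S" using finS by (intro psubset_card_mono) blast+
    then show False using le[OF Q(1), of A] AQ d cS by simp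
  qed
  have EFQ: "sym_diff (sym_diff (sym_diff A {e}) {f}) Q = sym_diff S {f}" unfolding S_def by blast
  have fS: "f \<notin> S"
  proof
    assume "f \<in> S"
    then have "card (sym_diff S {f}) < card S" using finS by (intro psubset_card_mono) blast+
    then show False using le[OF Q(1), of "sym_diff (sym_diff A {e}) {f}"] EFQ dk cS by simp
  qed
  have AfQ: "sym_diff (sym_diff A {f}) Q = insert e (insert f S)"
    using eS fS A(4) unfolding S_def by blast
  have AfE: "sym_diff A {f} \<subseteq> E" using A by blast
  obtain Y where Y: "Y \<in> F" "dist_to F (sym_diff A {f}) = card (sym_diff (sym_diff A {f}) Y)"
    and Ysub: "sym_diff Y Q \<subseteq> sym_diff (sym_diff A {f}) Q"
    by (rule nearest_member_between[OF F Q(1) AfE]) (rule that)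
  note Ysub = Ysub[unfolded AfQ]
  have finY: "finite Y" using fin Y by auto
  have "sym_diff (sym_diff A {f}) Y = sym_diff (sym_diff (sym_diff A {f}) Q) (sym_diff Y Q)" by blast
  also have "\<dots> = sym_diff (insert e (insert f S)) (sym_diff Y Q)" by (simp only: AfQ)
  also have "\<dots> = insert e (insert f S) - sym_diff Y Q" using Ysub by blast
  finally have "sym_diff (sym_diff A {f}) Y = insert e (insert f S) - sym_diff Y Q" .
  then have "card (insert e (insert f S)) - card (sym_diff Y Q) = k"
    using Y Ysub df finY finQ card_Diff_subset[of "sym_diff Y Q" "insert e (insert f S)"] by simp
  moreover have "card (insert e (insert f S)) = k + 1" using eS fS A(4) finS cS by simp
  ultimately have "card (sym_diff Y Q) = 1" using cS by linarith
  then obtain y where y: "sym_diff Y Q = {y}" by (auto simp: card_1_singleton_iff)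
  show False
  proof (cases "y = f")
    case True
    have "sym_diff (sym_diff (sym_diff A {e}) {f}) Y
        = sym_diff (sym_diff (sym_diff (sym_diff A {e}) {f}) Q) (sym_diff Y Q)" by blast
    also have "\<dots> = sym_diff (sym_diff S {f}) {f}" by (simp only: EFQ y True)
    also have "\<dots> = S" by blast
    finally have "sym_diff (sym_diff (sym_diff A {e}) {f}) Y = S" .
    then show False using le[OF Y(1), of "sym_diff (sym_diff A {e}) {f}"] dk cS by simp
  next
    case False
    then have yS: "y \<in> insert e S" using y Ysub by blast
    have "sym_diff A Y = sym_diff (sym_diff A Q) (sym_diff Y Q)" by blast
    also have "\<dots> = sym_diff (sym_diff S {e}) {y}" by (simp only: AQ y)
    also have "\<dots> = insert e S - {y}" using eS yS by blast
    finally have "sym_diff A Y = insert e S - {y}" .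
    then have "card (sym_diff A Y) = card S" using yS eS finS by simp
    then show False using le[OF Y(1), of A] d cS by simp
  qed
qed

lemma dist_to_eq_0_iff:
  assumes F: "binary_family E F" and fin: "finite A"
  shows "dist_to F A = 0 \<longleftrightarrow> A \<in> F"
proof
  note finF = binary_family_finite[OF F]
  assume "dist_to F A = 0"
  obtain X where X: "X \<in> F" "dist_to F A = card (sym_diff A X)"
    by (rule dist_to_attained[OF finF(1,2)]) (rule that)
  then have "sym_diff A X = {}" using \<open>dist_to F A = 0\<close> fin finF(5)[OF X(1)] by simp
  then have "A = X" by blast
  then show "A \<in> F" using X by simp
next
  assume "A \<in> F"
  then show "dist_to F A = 0"
    using dist_to_le[OF binary_family_finite(1)[OF F], of A A] by simp
qed

text \<open>On the subsets of a nearest member, the distance decreases at the full rate.\<close>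

lemma nearest_to_empty:
  assumes F: "binary_family E F"
  obtains B where "B \<subseteq> E" "dist_to F {} = card B" "\<And>Y. Y \<subseteq> B \<Longrightarrow> dist_to F Y + card Y = card B"
proof -
  note finF = binary_family_finite[OF F]
  obtain B where B: "B \<in> F" "dist_to F {} = card (sym_diff {} B)"
    by (rule dist_to_attained[OF finF(1,2)]) (rule that)
  then have dB: "dist_to F {} = card B" by simp
  have "dist_to F Y + card Y = card B" if Y: "Y \<subseteq> B" for Y
  proof -
    have fin: "finite B" "finite Y" using finF(5)[OF B(1)] Y finite_subset by auto
    have "sym_diff Y B = B - Y" using Y by blast
    then have "dist_to F Y \<le> card B - card Y"
      using dist_to_le[OF finF(1) B(1), of Y] Y fin by (simp add: card_Diff_subset)
    moreover have "card B \<le> dist_to F Y + card Y"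
      using dist_to_Lipschitz[OF F, of "{}" Y] fin dB by simp
    moreover have "card Y \<le> card B" using Y fin by (intro card_mono)
    ultimately show ?thesis by linarith
  qed
  then show thesis using that[of B] dB finF(4)[OF B(1)] by blast
qed

text \<open>If some member avoids \<open>e\<close>, a nearest member to a set without \<open>e\<close> can be chosen without \<open>e\<close>, and the
  distance does not change. Otherwise \<open>e\<close> is in all members and adds 1 to every such distance.\<close>

lemma binary_family_delete:
  assumes F: "binary_family E F" and e: "e \<in> E"
  shows "\<exists>k F'. binary_family (E - {e}) F' \<and> (\<forall>A. A \<subseteq> E - {e} \<longrightarrow> dist_to F A = k + dist_to F' A)"
proof (cases "\<exists>X\<in>F. e \<notin> X")
  case True
  note fin = binary_family_finite[OF F]
  obtain X0 where X0: "X0 \<in> F" "e \<notin> X0" using True by blast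
  define F' where "F' = {X \<in> F. e \<notin> X}"
  have F': "binary_family (E - {e}) F'"
    unfolding binary_family_def
  proof (intro conjI ballI)
    show "finite (E - {e})" "F' \<noteq> {}" using fin X0 by (auto simp: F'_def)
    show "F' \<subseteq> Pow (E - {e})" using fin(4) by (auto simp: F'_def)
    fix Q assume "Q \<in> F'"
    then have Q: "Q \<in> F" "e \<notin> Q" by (auto simp: F'_def)
    obtain C where C: "\<And>i j. C i j = C j i" "\<And>X. X \<subseteq> E \<Longrightarrow> sym_diff X Q \<in> F \<longleftrightarrow> nonsing C X"
      by (rule binary_familyE[OF F Q(1)]) (rule that)
    have "sym_diff X Q \<in> F' \<longleftrightarrow> nonsing C X" if X: "X \<subseteq> E - {e}" for X
    proof -
      have "e \<notin> sym_diff X Q" "X \<subseteq> E" using X Q by auto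
      then show ?thesis using C(2)[of X] by (simp add: F'_def)
    qed
    then show "\<exists>C. (\<forall>i j. C i j = C j i) \<and>
        (\<forall>X. X \<subseteq> E - {e} \<longrightarrow> (sym_diff X Q \<in> F' \<longleftrightarrow> nonsing C X))"
      using C(1) by blast
  qed
  note fin' = binary_family_finite[OF F']
  have "dist_to F A = 0 + dist_to F' A" if A: "A \<subseteq> E - {e}" for A
  proof (rule antisym)
    obtain X where X: "X \<in> F'" "dist_to F' A = card (sym_diff A X)"
      by (rule dist_to_attained[OF fin'(1,2)]) (rule that)
    then show "dist_to F A \<le> 0 + dist_to F' A"
      using dist_to_le[OF fin(1), of X A] by (simp add: F'_def)
    have AE: "A \<subseteq> E" using A by blast
    obtain Y where Y: "Y \<in> F" "dist_to F A = card (sym_diff A Y)" "sym_diff Y X0 \<subseteq> sym_diff A X0"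
      by (rule nearest_member_between[OF F X0(1) AE]) (rule that)
    have "e \<notin> Y" using Y(3) A X0(2) by blast
    then have "Y \<in> F'" using Y(1) by (simp add: F'_def)
    then show "0 + dist_to F' A \<le> dist_to F A"
      using dist_to_le[OF fin'(1), of Y A] Y(2) by simp
  qed
  then show ?thesis using F' by blast
next
  case False
  note fin = binary_family_finite[OF F]
  define F' where "F' = (\<lambda>X. X - {e}) ` F"
  have mem: "e \<in> X" if "X \<in> F" for X using False that by blast
  have F': "binary_family (E - {e}) F'"
    unfolding binary_family_def
  proof (intro conjI ballI)
    show "finite (E - {e})" "F' \<noteq> {}" using fin by (auto simp: F'_def)
    show "F' \<subseteq> Pow (E - {e})" using fin(4) by (auto simp: F'_def)
    fix Q' assume "Q' \<in> F'"
    then obtain Q where Q: "Q \<in> F" "Q' = Q - {e}" by (auto simp: F'_def)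
    obtain C where C: "\<And>i j. C i j = C j i" "\<And>X. X \<subseteq> E \<Longrightarrow> sym_diff X Q \<in> F \<longleftrightarrow> nonsing C X"
      by (rule binary_familyE[OF F Q(1)]) (rule that)
    have "sym_diff X Q' \<in> F' \<longleftrightarrow> nonsing C X" if X: "X \<subseteq> E - {e}" for X
    proof -
      have s: "sym_diff X Q - {e} = sym_diff X Q'" "insert e (sym_diff X Q') = sym_diff X Q"
        using X Q(2) mem[OF Q(1)] by auto
      have "sym_diff X Q' \<in> F' \<longleftrightarrow> sym_diff X Q \<in> F"
      proof
        assume "sym_diff X Q' \<in> F'"
        then obtain Z where Z: "Z \<in> F" "sym_diff X Q' = Z - {e}" by (auto simp: F'_def)
        then have "sym_diff X Q = Z" using s(2) mem[OF Z(1)] by (metis insert_Diff)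
        then show "sym_diff X Q \<in> F" using Z(1) by simp
      next
        assume "sym_diff X Q \<in> F"
        then show "sym_diff X Q' \<in> F'" unfolding F'_def by (rule rev_image_eqI) (rule s(1)[symmetric])
      qed
      then show ?thesis using C(2)[of X] X by blast
    qed
    then show "\<exists>C. (\<forall>i j. C i j = C j i) \<and>
        (\<forall>X. X \<subseteq> E - {e} \<longrightarrow> (sym_diff X Q' \<in> F' \<longleftrightarrow> nonsing C X))"
      using C(1) by blast
  qed
  have "dist_to F A = 1 + dist_to F' A" if A: "A \<subseteq> E - {e}" for A
  proof -
    have "card (sym_diff A X) = Suc (card (sym_diff A (X - {e})))" if X: "X \<in> F" for X
    proof -
      have "sym_diff A X = insert e (sym_diff A (X - {e}))" "e \<notin> sym_diff A (X - {e})"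
        using mem[OF X] A by auto
      then show ?thesis
        using fin(5)[OF X] finite_subset[OF A] fin(3) by simp
    qed
    then have "(\<lambda>X. card (sym_diff A X)) ` F = Suc ` (\<lambda>X. card (sym_diff A (X - {e}))) ` F"
      by (auto simp: image_image)
    then have "dist_to F A = Suc (Min ((\<lambda>X. card (sym_diff A (X - {e}))) ` F))"
      unfolding dist_to_def using fin(1,2) by (simp add: mono_Min_commute[symmetric] mono_Suc)
    then show ?thesis by (simp add: dist_to_def F'_def image_image)
  qed
  then show ?thesis using F' by blast
qed

section \<open>Sums of two distances have no parity gaps\<close>

text \<open>Here \<open>F2\<close> is the family of a symmetric matrix \<open>C\<close>, and \<open>B\<close> is a member of \<open>F1\<close> nearest to the empty
  set. The distances to \<open>F1\<close> are known on subsets of \<open>B\<close>, and the square rule controls them when one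
  element outside of \<open>B\<close> is added. The parity condition turns this into information on which small
  sets are nonsingular for \<open>C\<close>, and the outcome is that the columns of \<open>C\<close> with index in \<open>B\<close> coincide.\<close>

lemma no_antipodal_jump_at_member:
  assumes F1: "binary_family E F1" and F2: "binary_family E F2"
    and par: "\<And>A. A \<subseteq> E \<Longrightarrow> A \<noteq> {} \<Longrightarrow> A \<noteq> E \<Longrightarrow>
      odd (dist_to F1 A + dist_to F2 A + (dist_to F1 {} + dist_to F2 {}))"
    and jump: "dist_to F1 E + dist_to F2 E + 4 \<le> dist_to F1 {} + dist_to F2 {}"
    and zero: "dist_to F2 {} = 0"
  shows False
proof -
  note fin1 = binary_family_finite[OF F1] and fin2 = binary_family_finite[OF F2]
  let ?d1 = "dist_to F1" and ?d2 = "dist_to F2"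
  obtain B where B: "B \<subseteq> E" "?d1 {} = card B" "\<And>Y. Y \<subseteq> B \<Longrightarrow> ?d1 Y + card Y = card B"
    by (rule nearest_to_empty[OF F1]) (rule that)
  define q where "q = card B"
  have q4: "q \<ge> 4" using jump zero B(2) by (simp add: q_def)
  have finB: "finite B" using B(1) fin1(3) by (rule finite_subset)
  have dY: "?d1 Y + card Y = q" if "Y \<subseteq> B" for Y using B(3)[OF that] by (simp add: q_def)
  have cE: "card E \<ge> 4" using card_mono[OF fin1(3) B(1)] q4 by (simp add: q_def)
  have odd: "odd (?d1 A + ?d2 A + q)" if "A \<subseteq> E" "A \<noteq> {}" "card A \<le> 3" for A
    using par[OF that(1,2)] that(3) cE zero B(2) by (fastforce simp: q_def)
  have "{} \<in> F2" using dist_to_eq_0_iff[OF F2, of "{}"] zero by simp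
  then obtain C where sym: "\<And>i j. C i j = C j i"
    and C: "\<And>X. X \<subseteq> E \<Longrightarrow> sym_diff X {} \<in> F2 \<longleftrightarrow> nonsing C X"
    by (rule binary_familyE[OF F2]) (rule that)
  have d2: "?d2 X = 0 \<longleftrightarrow> nonsing C X" if "X \<subseteq> E" for X
    using C[OF that] dist_to_eq_0_iff[OF F2 finite_subset[OF that fin1(3)]] by simp
  have lip: "\<bar>int (?d1 (insert i A)) - int (?d1 A)\<bar> \<le> 1" "?d2 (insert i A) \<le> ?d2 A + 1"
    if "finite A" "i \<notin> A" for i A
  proof -
    have s: "sym_diff (insert i A) A = {i}" "sym_diff A (insert i A) = {i}" using that(2) by auto
    have "?d1 (insert i A) \<le> ?d1 A + 1" "?d1 A \<le> ?d1 (insert i A) + 1"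
      using dist_to_Lipschitz[OF F1, of "insert i A" A] dist_to_Lipschitz[OF F1, of A "insert i A"] that
      by (simp_all only: s finite_insert) simp_all
    then show "\<bar>int (?d1 (insert i A)) - int (?d1 A)\<bar> \<le> 1" by linarith
    show "?d2 (insert i A) \<le> ?d2 A + 1"
      using dist_to_Lipschitz[OF F2, of "insert i A" A] that by (simp only: s finite_insert) simp
  qed
  \<comment> \<open>One element of \<open>B\<close> lowers the first distance by 1, so the second one keeps its parity, and it is
     at most 1: the element is nonsingular for \<open>C\<close>. Two elements lower the first distance by 2, so
     the second one becomes odd and the pair is singular for \<open>C\<close>.\<close>
  have diag: "C e e = 1" if e: "e \<in> B" for e
  proof -
    have eE: "{e} \<subseteq> E" using e B(1) by blast
    have "?d1 {e} + 1 = q" using dY[of "{e}"] e by simp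
    moreover have "odd (?d1 {e} + ?d2 {e} + q)" using odd[of "{e}"] eE by simp
    moreover have "?d2 {e} \<le> 1" using lip(2)[of "{}" e] zero by simp
    ultimately have "?d2 {e} = 0" by presburger
    then show ?thesis using d2[OF eE] nonsing_singleton[of C e] by simp
  qed
  have offdiag: "C e g = 1" if e: "e \<in> B" and g: "g \<in> B" and ne: "e \<noteq> g" for e g
  proof -
    have E: "{e, g} \<subseteq> E" using e g B(1) by blast
    have "?d1 {e, g} + 2 = q" using dY[of "{e, g}"] e g ne by simp
    moreover have "odd (?d1 {e, g} + ?d2 {e, g} + q)" using odd[of "{e, g}"] E ne by simp
    ultimately have "?d2 {e, g} \<noteq> 0" by presburger
    then show ?thesis
      using d2[OF E] nonsing_pair[OF ne sym[of g e]] diag[OF e] diag[OF g] by simp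
  qed
  have outside: "C g f = 1" if f: "f \<in> E - B" and e: "e \<in> B" and g: "g \<in> B" and ef: "C e f = 1" for e g f
  proof (rule ccontr)
    assume "C g f \<noteq> 1"
    then have gf: "C g f = 0" by simp
    then have ne: "e \<noteq> g" using ef by auto
    have nf: "e \<noteq> f" "g \<noteq> f" using f e g by auto
    have E: "{e, g, f} \<subseteq> E" "{g, f} \<subseteq> E" "{f} \<subseteq> E" "{e, g} \<subseteq> E" "{g} \<subseteq> E" "{e} \<subseteq> E"
      using e g f B(1) by auto
    have de: "?d1 {g} + 1 = q" "?d1 {e, g} + 2 = q"
      using dY[of "{g}"] dY[of "{e, g}"] e g ne by simp_all
    have "nonsing C {e, g, f}"
      by (rule nonsing_triple[OF ne nf])
        (use diag[OF e] diag[OF g] offdiag[OF e g ne] ef gf sym in metis)+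
    then have "?d2 {e, g, f} = 0" using d2[OF E(1)] by simp
    then have o3: "odd (?d1 {e, g, f} + q)" using odd[of "{e, g, f}"] E ne nf by simp
    have o2: "odd (?d1 {g, f} + ?d2 {g, f} + q)" using odd[of "{g, f}"] E nf by simp
    \<comment> \<open>The triple is nonsingular, which fixes the parity of its first distance. The square at \<open>{g}\<close> in
       the directions \<open>e, f\<close> (if \<open>C f f = 1\<close>), or the one at \<open>{}\<close> in the directions \<open>g, f\<close> (otherwise),
       starts with one decreasing and one constant side, and the square rule contradicts the parity
       at its far corner.\<close>
    show False
    proof (cases "C f f = 1")
      case True
      then have "nonsing C {g, f}" using nonsing_pair[OF nf(2) sym[of f g]] diag[OF g] gf by simp
      then have "?d2 {g, f} = 0" using d2[OF E(2)] by simp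
      moreover have "\<bar>int (?d1 {g, f}) - int (?d1 {g})\<bar> \<le> 1"
        using lip(1)[of "{g}" f] nf by (simp add: insert_commute)
      ultimately have "?d1 {g, f} = ?d1 {g}" using o2 de(1) by presburger
      moreover have "sym_diff {g} {e} = {e, g}" "sym_diff {g} {f} = {g, f}"
        "sym_diff (sym_diff {g} {e}) {f} = {e, g, f}" using ne nf by auto
      ultimately have "?d1 {e, g, f} + 1 = ?d1 {g}"
        using dist_to_square[OF F1, of "{g}" e f "?d1 {g}"] E de nf(1) by simp
      then show False using o3 de(1) by presburger
    next
      case False
      then have ff: "C f f = 0" by simp
      then have "\<not> nonsing C {f}" using nonsing_singleton[of C f] by simp
      then have "?d2 {f} \<noteq> 0" using d2[OF E(3)] by simp
      moreover have "?d2 {f} \<le> 1" using lip(2)[of "{}" f] zero by simp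
      moreover have "odd (?d1 {f} + ?d2 {f} + q)" using odd[of "{f}"] E by simp
      moreover have "\<bar>int (?d1 {f}) - int (?d1 {})\<bar> \<le> 1" using lip(1)[of "{}" f] by simp
      ultimately have "?d1 {f} = ?d1 {}" using B(2) q_def by presburger
      moreover have "sym_diff {} {g} = {g}" "sym_diff {} {f} = {f}"
        "sym_diff (sym_diff {} {g}) {f} = {g, f}" using nf by auto
      ultimately have d1gf: "?d1 {g, f} + 1 = q"
        using dist_to_square[OF F1, of "{}" g f q] E de nf(2) B(2) by (simp add: q_def)
      have "\<not> nonsing C {g, f}" using nonsing_pair[OF nf(2) sym[of f g]] ff gf by simp
      then have "?d2 {g, f} \<noteq> 0" using d2[OF E(2)] by simp
      moreover have "?d2 {g} = 0" using d2[OF E(5)] nonsing_singleton[of C g] diag[OF g] by simp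
      moreover have "?d2 {g, f} \<le> ?d2 {g} + 1"
        using lip(2)[of "{g}" f] nf by (simp add: insert_commute)
      ultimately have "?d2 {g, f} = 1" by linarith
      then show False using o2 d1gf by presburger
    qed
  qed
  have columns: "C i e = C i g" if "e \<in> B" "g \<in> B" "i \<in> E" for i e g
  proof (cases "i \<in> B")
    case True
    then show ?thesis using diag offdiag that by metis
  next
    case False
    then have "C e i = 1 \<longleftrightarrow> C g i = 1" using outside that by blast
    then show ?thesis using sym[of i e] sym[of i g] by (metis bit_not_one_iff)
  qed
  obtain X where X: "X \<in> F2" "?d2 E = card (sym_diff E X)"
    by (rule dist_to_attained[OF fin2(1,2)]) (rule that)
  have XE: "X \<subseteq> E" "finite X" using fin2(4,5)[OF X(1)] by auto
  have nX: "nonsing C X" using C[OF XE(1)] X(1) by simp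
  \<comment> \<open>Equal columns make an index set with two elements of \<open>B\<close> singular.\<close>
  have "e = g" if "e \<in> X \<inter> B" "g \<in> X \<inter> B" for e g
    using not_nonsing_equal_columns[OF XE(2), of e g C] columns that nX XE(1) by blast
  then have "card (X \<inter> B) \<le> 1"
    using card_le_Suc0_iff_eq[of "X \<inter> B"] XE by auto
  moreover have "card (B - X) = q - card (X \<inter> B)"
    using finB by (simp add: card_Diff_subset_Int q_def Int_commute)
  moreover have "card (B - X) \<le> card (sym_diff E X)"
    using B(1) fin1(3) XE by (intro card_mono) auto
  ultimately have "?d2 E + 1 \<ge> q" using X(2) by linarith
  then show False using jump zero B(2) q_def by linarith
qed

text \<open>If both distances were positive at the empty set, there would be an element \<open>e\<close> that lowers the
  first and an element \<open>g\<close> that lowers the second. By parity, each leaves the other distance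
  constant. The square rule, used once for each distance, then shows that \<open>{e, g}\<close> lowers the sum by
  exactly 2, against the parity condition.\<close>

lemma no_antipodal_jump:
  assumes F1: "binary_family E F1" and F2: "binary_family E F2"
    and par: "\<And>A. A \<subseteq> E \<Longrightarrow> A \<noteq> {} \<Longrightarrow> A \<noteq> E \<Longrightarrow>
      odd (dist_to F1 A + dist_to F2 A + (dist_to F1 {} + dist_to F2 {}))"
    and jump: "dist_to F1 E + dist_to F2 E + 4 \<le> dist_to F1 {} + dist_to F2 {}"
  shows False
proof -
  let ?d1 = "dist_to F1" and ?d2 = "dist_to F2"
  have lip: "\<bar>int (dist_to F {i}) - int (dist_to F {})\<bar> \<le> 1" if F: "binary_family E F" for F i
    using dist_to_Lipschitz[OF F, of "{i}" "{}"] dist_to_Lipschitz[OF F, of "{}" "{i}"] by simp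
  have desc: "\<exists>e\<in>E. dist_to F {e} + 1 = dist_to F {}"
    if F: "binary_family E F" and pos: "dist_to F {} \<noteq> 0" for F
  proof -
    obtain B where B: "B \<subseteq> E" "dist_to F {} = card B"
      "\<And>Y. Y \<subseteq> B \<Longrightarrow> dist_to F Y + card Y = card B"
      by (rule nearest_to_empty[OF F]) (rule that)
    then obtain e where "e \<in> B" using pos by fastforce
    then have "dist_to F {e} + 1 = dist_to F {}" using B(2) B(3)[of "{e}"] by simp
    then show ?thesis using B(1) \<open>e \<in> B\<close> by blast
  qed
  consider "?d1 {} = 0" | "?d2 {} = 0" | "?d1 {} \<noteq> 0" "?d2 {} \<noteq> 0" by blast
  then show False
  proof cases
    case 1
    show False
    proof (rule no_antipodal_jump_at_member[OF F2 F1 _ _ 1])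
      show "odd (?d2 A + ?d1 A + (?d2 {} + ?d1 {}))" if "A \<subseteq> E" "A \<noteq> {}" "A \<noteq> E" for A
        using par[OF that] by (simp add: add.commute)
    qed (use jump in simp)
  next
    case 2
    then show False using no_antipodal_jump_at_member[OF F1 F2 par jump] by blast
  next
    case 3
    obtain e where e: "e \<in> E" "?d1 {e} + 1 = ?d1 {}" using desc[OF F1 3(1)] by blast
    obtain g where g: "g \<in> E" "?d2 {g} + 1 = ?d2 {}" using desc[OF F2 3(2)] by blast
    note lips = lip[OF F1, of e] lip[OF F2, of e] lip[OF F1, of g] lip[OF F2, of g]
    have "{e} \<noteq> E" "{g} \<noteq> E"
      using jump lips by auto
    then have "odd (?d1 {e} + ?d2 {e} + (?d1 {} + ?d2 {}))" "odd (?d1 {g} + ?d2 {g} + (?d1 {} + ?d2 {}))"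
      using par[of "{e}"] par[of "{g}"] e g by auto
    then have d: "?d2 {e} = ?d2 {}" "?d1 {g} = ?d1 {}"
      using lips e(2) g(2) by presburger+
    then have ne: "e \<noteq> g" using e(2) by auto
    have s: "sym_diff {} {e} = {e}" "sym_diff {} {g} = {g}"
      "sym_diff (sym_diff {} {e}) {g} = {e, g}" "sym_diff (sym_diff {} {g}) {e} = {e, g}"
      using ne by auto
    have d1: "?d1 {e, g} + 1 = ?d1 {}"
      using dist_to_square[OF F1, of "{}" e g "?d1 {}"] e g d ne s by (simp add: insert_commute)
    have d2: "?d2 {e, g} + 1 = ?d2 {}"
      using dist_to_square[OF F2, of "{}" g e "?d2 {}"] e g d ne s by (simp add: insert_commute)
    have "{e, g} \<noteq> E" using jump d1 d2 by auto
    then have "odd (?d1 {e, g} + ?d2 {e, g} + (?d1 {} + ?d2 {}))"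
      using par[of "{e, g}"] e g by auto
    then show False using d1 d2 by presburger
  qed
qed

text \<open>Induction on the ground set; the constant \<open>k\<close> absorbs the shifts that deletions cause. Unless \<open>P\<close>
  and \<open>Q\<close> are complementary, a twist by \<open>Q\<close> followed by a deletion reduces the claim. If they are
  complementary, the same reduction applies to \<open>(R, Q)\<close> or \<open>(P, R)\<close> for every other set \<open>R\<close> with a
  value of the parity of \<open>c\<close>, so that only the situation of \<open>no_antipodal_jump\<close> is left.\<close>

lemma no_parity_gap:
  assumes "binary_family E F1" "binary_family E F2" "P \<subseteq> E" "Q \<subseteq> E"
    and "k + dist_to F1 P + dist_to F2 P < c" "c < k + dist_to F1 Q + dist_to F2 Q"
    and "even (k + dist_to F1 P + dist_to F2 P + c)" "even (k + dist_to F1 Q + dist_to F2 Q + c)"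
  shows "\<exists>A\<subseteq>E. k + dist_to F1 A + dist_to F2 A = c"
  using assms
proof (induction "card E" arbitrary: E F1 F2 P Q k rule: less_induct)
  case less
  note F1 = less.prems(1) and F2 = less.prems(2)
  note finE = binary_family_finite(3)[OF F1]
  define f where "f A = k + dist_to F1 A + dist_to F2 A" for A
  have reduce: "\<exists>A\<subseteq>E. f A = c"
    if sub: "P' \<subseteq> E" "Q' \<subseteq> E" and ne: "sym_diff P' Q' \<noteq> E"
      and lt: "f P' < c" "c < f Q'" and ev: "even (f P' + c)" "even (f Q' + c)" for P' Q'
  proof -
    obtain e where e: "e \<in> E" "e \<notin> sym_diff P' Q'" using sub ne by blast
    define R where "R = sym_diff P' Q'"
    have R: "R \<subseteq> E - {e}" using sub e by (auto simp: R_def)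
    note G1 = binary_family_twist[OF F1 sub(2)] and G2 = binary_family_twist[OF F2 sub(2)]
    obtain k1 H1 where H1: "binary_family (E - {e}) H1"
      "\<And>A. A \<subseteq> E - {e} \<Longrightarrow> dist_to F1 (sym_diff A Q') = k1 + dist_to H1 A"
      using binary_family_delete[OF G1 e(1)] unfolding dist_to_twist by blast
    obtain k2 H2 where H2: "binary_family (E - {e}) H2"
      "\<And>A. A \<subseteq> E - {e} \<Longrightarrow> dist_to F2 (sym_diff A Q') = k2 + dist_to H2 A"
      using binary_family_delete[OF G2 e(1)] unfolding dist_to_twist by blast
    have f: "f (sym_diff A Q') = (k + k1 + k2) + dist_to H1 A + dist_to H2 A" if "A \<subseteq> E - {e}" for A
      using H1(2)[OF that] H2(2)[OF that] by (simp add: f_def)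
    have s: "sym_diff R Q' = P'" "sym_diff {} Q' = Q'" by (auto simp: R_def)
    have "\<exists>A\<subseteq>E - {e}. (k + k1 + k2) + dist_to H1 A + dist_to H2 A = c"
    proof (rule less.hyps[OF _ H1(1) H2(1) R, of "{}"])
      show "card (E - {e}) < card E" using e(1) finE by (intro psubset_card_mono) auto
    qed (use lt ev f[OF R] f[of "{}"] in \<open>simp_all only: s empty_subsetI\<close>)
    then obtain A where A: "A \<subseteq> E - {e}" "f (sym_diff A Q') = c" using f by metis
    moreover have "sym_diff A Q' \<subseteq> E" using A(1) sub(2) by blast
    ultimately show ?thesis by blast
  qed
  note PQ = less.prems(3-8)[folded f_def]
  have "\<exists>A\<subseteq>E. f A = c"
  proof (rule ccontr)
    assume none: "\<not> (\<exists>A\<subseteq>E. f A = c)"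
    have E: "sym_diff P Q = E" using reduce[OF PQ(1,2) _ PQ(3-6)] none by blast
    have odd: "odd (f R + c)" if R: "R \<subseteq> E" "R \<noteq> P" "R \<noteq> Q" for R
    proof
      assume ev: "even (f R + c)"
      have "sym_diff R Q \<noteq> E" using R(2) E by blast
      moreover have "sym_diff P R \<noteq> E" using R(3) E by blast
      moreover have "f R < c \<or> c < f R" using none R(1) by (metis linorder_neqE_nat)
      ultimately show False
        using reduce[OF R(1) PQ(2) _ _ PQ(4) ev PQ(6)] reduce[OF PQ(1) R(1) _ PQ(3) _ PQ(5) ev] none
        by blast
    qed
    have EQ: "sym_diff E Q = P" "sym_diff {} Q = Q" using E by blast+
    show False
    proof (rule no_antipodal_jump[OF binary_family_twist[OF F1 PQ(2)] binary_family_twist[OF F2 PQ(2)]];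
        unfold dist_to_twist EQ)
      fix A assume A: "A \<subseteq> E" "A \<noteq> {}" "A \<noteq> E"
      have "sym_diff A Q \<subseteq> E" "sym_diff A Q \<noteq> P" "sym_diff A Q \<noteq> Q" using A PQ(2) E by blast+
      from odd[OF this] PQ(6)
      have "odd (f (sym_diff A Q) + f Q)" by presburger
      then show "odd (dist_to F1 (sym_diff A Q) + dist_to F2 (sym_diff A Q)
          + (dist_to F1 Q + dist_to F2 Q))"
        unfolding f_def by presburger
    next
      have "f P + 4 \<le> f Q" using PQ(3-6) by presburger
      then show "dist_to F1 P + dist_to F2 P + 4 \<le> dist_to F1 Q + dist_to F2 Q"
        by (simp add: f_def)
    qed
  qed
  then show ?case by (simp add: f_def)
qed

section \<open>Lagrangian spaces\<close>

type_synonym 'a bivec = "('a \<Rightarrow> bit) \<times> ('a \<Rightarrow> bit)"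

lemma bit_add_eq_0_iff: "a + b = 0 \<longleftrightarrow> a = b" for a b :: bit
  by (cases a; cases b) auto

lemma bit_add_self: "a + a = 0" for a :: bit
  by (cases a) auto

definition symplectic :: "'a set \<Rightarrow> 'a bivec \<Rightarrow> 'a bivec \<Rightarrow> bit" where
  "symplectic E p q = (\<Sum>i\<in>E. fst p i * snd q i + snd p i * fst q i)"

definition add_bivec :: "'a bivec \<Rightarrow> 'a bivec \<Rightarrow> 'a bivec" where
  "add_bivec p q = (\<lambda>i. fst p i + fst q i, \<lambda>i. snd p i + snd q i)"

text \<open>Lagrangian means isotropic of half the dimension. Over GF(2) the dimension can be expressed by the
  number of elements, and a finite set closed under addition is a subspace as soon as it is not empty.\<close>

definition lagrangian :: "'a set \<Rightarrow> 'a bivec set \<Rightarrow> bool" where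
  "lagrangian E L \<longleftrightarrow> finite E \<and> (\<forall>p\<in>L. \<forall>i. i \<notin> E \<longrightarrow> fst p i = 0 \<and> snd p i = 0) \<and>
     (\<forall>p\<in>L. \<forall>q\<in>L. add_bivec p q \<in> L) \<and> (\<forall>p\<in>L. \<forall>q\<in>L. symplectic E p q = 0) \<and>
     card L = 2 ^ card E"

text \<open>The set \<open>A\<close> stands for the coordinate subspace on which \<open>u\<close> vanishes inside \<open>A\<close> and \<open>v\<close> vanishes
  outside of it. It is the common zero set of the functionals \<open>\<lambda>p. coord A p i\<close>.\<close>

definition coord :: "'a set \<Rightarrow> 'a bivec \<Rightarrow> 'a \<Rightarrow> bit" where
  "coord A p i = (if i \<in> A then fst p i else snd p i)"

definition transversal_family :: "'a set \<Rightarrow> 'a bivec set \<Rightarrow> 'a set set" where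
  "transversal_family E L =
     {A. A \<subseteq> E \<and> (\<forall>p\<in>L. (\<forall>i. coord A p i = 0) \<longrightarrow> (\<forall>i. fst p i = 0 \<and> snd p i = 0))}"

lemma mem_transversal_family_cong:
  assumes "A \<subseteq> E \<longleftrightarrow> B \<subseteq> E"
    and c: "\<And>p i. coord A (\<phi> p) i = coord B (\<psi> p) i"
    and z: "\<And>p i. fst (\<phi> p) i = 0 \<and> snd (\<phi> p) i = 0 \<longleftrightarrow> fst (\<psi> p) i = 0 \<and> snd (\<psi> p) i = 0"
  shows "A \<in> transversal_family E (\<phi> ` L) \<longleftrightarrow> B \<in> transversal_family E (\<psi> ` L)"
  using assms(1) by (simp add: transversal_family_def c z)

text \<open>The counterpart of a twist.\<close>

definition swap_on :: "'a set \<Rightarrow> 'a bivec \<Rightarrow> 'a bivec" where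
  "swap_on B p = (\<lambda>i. if i \<in> B then snd p i else fst p i, \<lambda>i. if i \<in> B then fst p i else snd p i)"

text \<open>The counterpart of loop complementation. At one coordinate, this map and the exchange of the two
  components generate all permutations of the three nonzero vectors of the plane.\<close>

definition shear_on :: "'a set \<Rightarrow> 'a bivec \<Rightarrow> 'a bivec" where
  "shear_on B p = (\<lambda>i. if i \<in> B then fst p i + snd p i else fst p i, snd p)"

lemma swap_on_swap_on: "swap_on B (swap_on B p) = p"
  by (cases p) (auto simp: swap_on_def)

lemma shear_on_shear_on: "shear_on B (shear_on B p) = p"
  by (cases p) (auto simp: shear_on_def fun_eq_iff add.assoc bit_add_self)

lemma lagrangian_image:
  assumes L: "lagrangian E L" and inv: "\<And>p. \<phi> (\<phi> p) = p"
    and supp: "\<And>p i. fst p i = 0 \<Longrightarrow> snd p i = 0 \<Longrightarrow> fst (\<phi> p) i = 0 \<and> snd (\<phi> p) i = 0"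
    and add: "\<And>p q. \<phi> (add_bivec p q) = add_bivec (\<phi> p) (\<phi> q)"
    and form: "\<And>p q i. fst (\<phi> p) i * snd (\<phi> q) i + snd (\<phi> p) i * fst (\<phi> q) i =
      fst p i * snd q i + snd p i * fst q i"
  shows "lagrangian E (\<phi> ` L)"
proof -
  have "inj_on \<phi> L" using inv by (metis inj_onI)
  then have "card (\<phi> ` L) = 2 ^ card E" using L by (simp add: card_image lagrangian_def)
  moreover have "\<forall>p\<in>\<phi> ` L. \<forall>i. i \<notin> E \<longrightarrow> fst p i = 0 \<and> snd p i = 0"
    using L supp by (auto simp: lagrangian_def)
  moreover have "\<forall>p\<in>\<phi> ` L. \<forall>q\<in>\<phi> ` L. add_bivec p q \<in> \<phi> ` L"
    using L add[symmetric] by (auto simp: lagrangian_def)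
  moreover have "symplectic E (\<phi> p) (\<phi> q) = symplectic E p q" for p q
    unfolding symplectic_def form ..
  ultimately show ?thesis using L by (simp add: lagrangian_def)
qed

lemma lagrangian_swap_on: "lagrangian E L \<Longrightarrow> lagrangian E (swap_on B ` L)"
  by (rule lagrangian_image) (auto simp: swap_on_swap_on, auto simp: swap_on_def add_bivec_def add.commute)

lemma lagrangian_shear_on: "lagrangian E L \<Longrightarrow> lagrangian E (shear_on B ` L)"
proof (rule lagrangian_image)
  fix p q :: "'a bivec" and i
  show "fst (shear_on B p) i * snd (shear_on B q) i + snd (shear_on B p) i * fst (shear_on B q) i =
      fst p i * snd q i + snd p i * fst q i"
    by (cases "fst p i"; cases "snd p i"; cases "fst q i"; cases "snd q i") (auto simp: shear_on_def)
qed (auto simp: shear_on_shear_on, auto simp: shear_on_def add_bivec_def fun_eq_iff ac_simps)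

lemma transversal_family_swap_on:
  assumes "A \<subseteq> E" "B \<subseteq> E"
  shows "A \<in> transversal_family E (swap_on B ` L) \<longleftrightarrow> sym_diff A B \<in> transversal_family E L"
proof -
  have "A \<in> transversal_family E (swap_on B ` L) \<longleftrightarrow> sym_diff A B \<in> transversal_family E (id ` L)"
    using assms by (intro mem_transversal_family_cong) (auto simp: coord_def swap_on_def)
  then show ?thesis by simp
qed

definition graph_space :: "'a set \<Rightarrow> ('a \<Rightarrow> 'a \<Rightarrow> bit) \<Rightarrow> 'a bivec set" where
  "graph_space E C = (\<lambda>v. (\<lambda>i. if i \<in> E then \<Sum>j\<in>E. C i j * v j else 0, v)) ` {v. \<forall>i. i \<notin> E \<longrightarrow> v i = 0}"

lemma card_supported:
  assumes "finite E"
  shows "card {v :: 'a \<Rightarrow> bit. \<forall>i. i \<notin> E \<longrightarrow> v i = 0} = 2 ^ card E"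
    and "finite {v :: 'a \<Rightarrow> bit. \<forall>i. i \<notin> E \<longrightarrow> v i = 0}"
proof -
  let ?g = "\<lambda>A i. of_bool (i \<in> A) :: bit"
  have img: "{v :: 'a \<Rightarrow> bit. \<forall>i. i \<notin> E \<longrightarrow> v i = 0} = ?g ` Pow E"
  proof (intro equalityI subsetI)
    fix v :: "'a \<Rightarrow> bit" assume v: "v \<in> {v. \<forall>i. i \<notin> E \<longrightarrow> v i = 0}"
    have "v = ?g {i. v i = 1}" by (auto simp: fun_eq_iff)
    moreover have "{i. v i = 1} \<in> Pow E" using v by auto
    ultimately show "v \<in> ?g ` Pow E" by (rule image_eqI)
  qed auto
  have "inj_on ?g (Pow E)"
    by (rule inj_on_inverseI[where g = "\<lambda>v. {i. v i = 1}"]) auto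
  then show "card {v :: 'a \<Rightarrow> bit. \<forall>i. i \<notin> E \<longrightarrow> v i = 0} = 2 ^ card E"
    unfolding img using assms by (simp add: card_image card_Pow)
  show "finite {v :: 'a \<Rightarrow> bit. \<forall>i. i \<notin> E \<longrightarrow> v i = 0}" unfolding img using assms by simp
qed

lemma lagrangian_graph_space:
  assumes fin: "finite E" and sym: "\<And>i j. C i j = C j i"
  shows "lagrangian E (graph_space E C)"
  unfolding lagrangian_def
proof (intro conjI ballI allI impI)
  let ?V = "{v :: 'a \<Rightarrow> bit. \<forall>i. i \<notin> E \<longrightarrow> v i = 0}"
  have "card (graph_space E C) = card ?V"
    unfolding graph_space_def by (rule card_image) (auto intro: inj_onI)
  then show "card (graph_space E C) = 2 ^ card E" using card_supported[OF fin] by simp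
  fix p q assume "p \<in> graph_space E C" "q \<in> graph_space E C"
  then obtain v w where v: "v \<in> ?V" "p = (\<lambda>i. if i \<in> E then \<Sum>j\<in>E. C i j * v j else 0, v)"
    and w: "w \<in> ?V" "q = (\<lambda>i. if i \<in> E then \<Sum>j\<in>E. C i j * w j else 0, w)"
    by (auto simp: graph_space_def)
  have "add_bivec p q = (\<lambda>i. if i \<in> E then \<Sum>j\<in>E. C i j * (v j + w j) else 0, \<lambda>j. v j + w j)"
    by (simp add: add_bivec_def v(2) w(2) fun_eq_iff distrib_left sum.distrib)
  moreover have "(\<lambda>j. v j + w j) \<in> ?V" using v w by auto
  ultimately show "add_bivec p q \<in> graph_space E C" unfolding graph_space_def by (rule image_eqI)
  have "symplectic E p q = (\<Sum>i\<in>E. \<Sum>j\<in>E. C i j * v j * w i) + (\<Sum>i\<in>E. \<Sum>j\<in>E. v i * (C i j * w j))"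
    by (simp add: symplectic_def v(2) w(2) sum.distrib sum_distrib_left sum_distrib_right)
  also have "(\<Sum>i\<in>E. \<Sum>j\<in>E. v i * (C i j * w j)) = (\<Sum>j\<in>E. \<Sum>i\<in>E. v i * (C i j * w j))"
    by (rule sum.swap)
  also have "\<dots> = (\<Sum>i\<in>E. \<Sum>j\<in>E. C i j * v j * w i)"
    by (intro sum.cong refl) (use sym in \<open>simp add: ac_simps\<close>)
  finally show "symplectic E p q = 0" by (simp only: bit_add_self)
qed (auto simp: graph_space_def fin)

lemma transversal_family_graph_space:
  assumes fin: "finite E" and X: "X \<subseteq> E"
  shows "X \<in> transversal_family E (graph_space E C) \<longleftrightarrow> nonsing C X"
proof -
  have *: "(\<Sum>j\<in>E. C i j * v j) = (\<Sum>j\<in>X. C i j * v j)" if "\<forall>i. i \<notin> X \<longrightarrow> v i = 0" for i v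
    using that X fin by (intro sum.mono_neutral_right) auto
  show ?thesis
  proof
    assume t: "X \<in> transversal_family E (graph_space E C)"
    show "nonsing C X"
      unfolding nonsing_def
    proof (intro allI impI)
      fix v i assume v: "\<forall>i. i \<notin> X \<longrightarrow> v i = 0" "\<forall>i\<in>X. (\<Sum>j\<in>X. C i j * v j) = 0"
      have "(\<lambda>i. if i \<in> E then \<Sum>j\<in>E. C i j * v j else 0, v) \<in> graph_space E C"
        unfolding graph_space_def using v X by (intro imageI) auto
      then have "\<forall>i. (if i \<in> E then \<Sum>j\<in>E. C i j * v j else 0) = 0 \<and> v i = 0"
        using t v *[OF v(1)] by (auto simp: transversal_family_def coord_def)
      then show "v i = 0" by blast
    qed
  next
    assume n: "nonsing C X"
    have "\<forall>i. fst p i = 0 \<and> snd p i = 0"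
      if p: "p \<in> graph_space E C" and z: "\<forall>i. coord X p i = 0" for p
    proof -
      obtain v where v: "p = (\<lambda>i. if i \<in> E then \<Sum>j\<in>E. C i j * v j else 0, v)"
        using p by (auto simp: graph_space_def)
      have v0: "\<forall>i. i \<notin> X \<longrightarrow> v i = 0" 
      proof (intro allI impI)
        fix i assume "i \<notin> X"
        then show "v i = 0" using spec[OF z, of i] by (simp add: v coord_def)
      qed
      moreover have "\<forall>i\<in>X. (\<Sum>j\<in>X. C i j * v j) = 0"
      proof
        fix i assume "i \<in> X"
        then show "(\<Sum>j\<in>X. C i j * v j) = 0"
          using spec[OF z, of i] X *[OF v0, of i] by (auto simp: v coord_def)
      qed
      ultimately have "\<forall>i. v i = 0" using n unfolding nonsing_def by blast
      then show ?thesis using v by simp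
    qed
    then show "X \<in> transversal_family E (graph_space E C)"
      using X unfolding transversal_family_def by blast
  qed
qed

text \<open>As the empty set belongs to the family, a vector of \<open>L\<close> is determined by its second component, and
  a count shows that all second components occur. The vectors \<open>w j\<close> over the unit vectors give the
  columns of \<open>C\<close>. Isotropy against \<open>w j\<close> yields both the symmetry of \<open>C\<close> and \<open>u = C v\<close>.\<close>

lemma lagrangian_eq_graph_space:
  assumes L: "lagrangian E L" and empty: "{} \<in> transversal_family E L"
  obtains C where "\<And>i j. C i j = C j i" "L = graph_space E C"
proof -
  have fin: "finite E" and supp: "\<And>p i. p \<in> L \<Longrightarrow> i \<notin> E \<Longrightarrow> fst p i = 0 \<and> snd p i = 0"
    and add: "\<And>p q. p \<in> L \<Longrightarrow> q \<in> L \<Longrightarrow> add_bivec p q \<in> L"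
    and form: "\<And>p q. p \<in> L \<Longrightarrow> q \<in> L \<Longrightarrow> symplectic E p q = 0" and card: "card L = 2 ^ card E"
    using L by (auto simp: lagrangian_def)
  let ?V = "{v :: 'a \<Rightarrow> bit. \<forall>i. i \<notin> E \<longrightarrow> v i = 0}"
  have "inj_on snd L"
  proof (rule inj_onI)
    fix p q assume pq: "p \<in> L" "q \<in> L" "snd p = snd q"
    have "\<forall>i. snd (add_bivec p q) i = 0" using pq(3) by (simp add: add_bivec_def bit_add_self)
    then have "\<forall>i. fst (add_bivec p q) i = 0"
      using empty add[OF pq(1,2)] by (simp add: transversal_family_def coord_def)
    then have "fst p = fst q" by (auto simp: add_bivec_def bit_add_eq_0_iff fun_eq_iff)
    then show "p = q" using pq(3) by (simp add: prod_eq_iff)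
  qed
  then have "card (snd ` L) = card ?V" using card card_supported[OF fin] by (simp add: card_image)
  moreover have "snd ` L \<subseteq> ?V" using supp by auto
  ultimately have onto: "snd ` L = ?V" using card_supported[OF fin] by (simp add: card_subset_eq)
  define \<delta> :: "'a \<Rightarrow> 'a \<Rightarrow> bit" where "\<delta> j = (\<lambda>i. if i = j then 1 else 0)" for j
  have "\<forall>j\<in>E. \<exists>p. p \<in> L \<and> snd p = \<delta> j"
  proof
    fix j assume "j \<in> E"
    then have "\<delta> j \<in> snd ` L" unfolding onto by (auto simp: \<delta>_def)
    then show "\<exists>p. p \<in> L \<and> snd p = \<delta> j" by auto
  qed
  then obtain w where "\<forall>j\<in>E. w j \<in> L \<and> snd (w j) = \<delta> j"
    using bchoice[of E "\<lambda>j p. p \<in> L \<and> snd p = \<delta> j"] by blast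
  then have w: "\<And>j. j \<in> E \<Longrightarrow> w j \<in> L" "\<And>j. j \<in> E \<Longrightarrow> snd (w j) = (\<lambda>i. if i = j then 1 else 0)"
    unfolding \<delta>_def by blast+
  define C where "C i j = (if j \<in> E then fst (w j) i else 0)" for i j
  have pair: "fst p j = (\<Sum>i\<in>E. snd p i * fst (w j) i)" if "p \<in> L" "j \<in> E" for p j
  proof -
    have "0 = symplectic E p (w j)" using form[OF that(1) w(1)[OF that(2)]] by simp
    also have "\<dots> = (\<Sum>i\<in>E. if i = j then fst p i else 0) + (\<Sum>i\<in>E. snd p i * fst (w j) i)"
      unfolding symplectic_def w(2)[OF that(2)] sum.distrib by (intro arg_cong2[of _ _ _ _ "(+)"] sum.cong) auto
    also have "(\<Sum>i\<in>E. if i = j then fst p i else 0) = fst p j" using fin that(2) by simp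
    finally show ?thesis by (metis bit_add_eq_0_iff)
  qed
  have sym: "C i j = C j i" for i j
  proof (cases "i \<in> E \<and> j \<in> E")
    case True
    have "fst (w j) i = (\<Sum>k\<in>E. if k = j then fst (w i) k else 0)"
      using pair[OF w(1), of j i] True w(2)[of j] by (simp add: if_distrib[of "\<lambda>x. x * _"] cong: if_cong)
    also have "\<dots> = fst (w i) j" using fin True by simp
    finally show ?thesis using True by (simp add: C_def)
  next
    case False
    then show ?thesis using supp w(1) by (auto simp: C_def)
  qed
  have fst_eq: "fst p = (\<lambda>i. if i \<in> E then \<Sum>j\<in>E. C i j * snd p j else 0)" if p: "p \<in> L" for p
  proof
    fix i
    have "snd p j * fst (w i) j = C i j * snd p j" if "i \<in> E" for j
      using that sym[of i j] by (simp add: C_def[of j i] mult.commute)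
    then have "(\<Sum>j\<in>E. snd p j * fst (w i) j) = (\<Sum>j\<in>E. C i j * snd p j)" if "i \<in> E"
      using that by (intro sum.cong refl)
    then show "fst p i = (if i \<in> E then \<Sum>j\<in>E. C i j * snd p j else 0)"
      using pair[OF p, of i] supp[OF p, of i] by simp
  qed
  have "L = (\<lambda>v. (\<lambda>i. if i \<in> E then \<Sum>j\<in>E. C i j * v j else 0, v)) ` snd ` L"
  proof -
    have "p = (\<lambda>i. if i \<in> E then \<Sum>j\<in>E. C i j * snd p j else 0, snd p)" if "p \<in> L" for p
      using fst_eq[OF that] by (simp add: prod_eq_iff)
    then show ?thesis by (force simp: image_image)
  qed
  then have "L = graph_space E C" unfolding onto graph_space_def .
  then show thesis using that[of C] sym by blast
qed

text \<open>Principal pivoting without formulas: exchanging the components on \<open>Q\<close> moves the member \<open>Q\<close> to the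
  empty set, and the new space is the graph of the pivoted matrix.\<close>

lemma transversal_family_binary:
  assumes L: "lagrangian E L" and ne: "transversal_family E L \<noteq> {}"
  shows "binary_family E (transversal_family E L)"
  unfolding binary_family_def
proof (intro conjI ballI)
  show "finite E" using L by (simp add: lagrangian_def)
  show "transversal_family E L \<subseteq> Pow E" by (auto simp: transversal_family_def)
  fix Q assume Q: "Q \<in> transversal_family E L"
  then have QE: "Q \<subseteq> E" by (auto simp: transversal_family_def)
  have "{} \<in> transversal_family E (swap_on Q ` L)"
    using Q QE by (simp add: transversal_family_swap_on)
  then obtain C where C: "\<And>i j. C i j = C j i" "swap_on Q ` L = graph_space E C"
    by (rule lagrangian_eq_graph_space[OF lagrangian_swap_on[OF L]]) (rule that)
  have "sym_diff X Q \<in> transversal_family E L \<longleftrightarrow> nonsing C X" if "X \<subseteq> E" for X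
    using transversal_family_swap_on[OF that QE, of L]
      transversal_family_graph_space[OF _ that, of C] C(2) L by (simp add: lagrangian_def)
  then show "\<exists>C. (\<forall>i j. C i j = C j i) \<and>
      (\<forall>X. X \<subseteq> E \<longrightarrow> (sym_diff X Q \<in> transversal_family E L \<longleftrightarrow> nonsing C X))"
    using C(1) by blast
qed (rule ne)

lemma shear_on_graph_space:
  assumes "finite E" "e \<in> E"
  shows "shear_on {e} ` graph_space E C = graph_space E (\<lambda>i j. C i j + (if i = e \<and> j = e then 1 else 0))"
proof -
  have "shear_on {e} (\<lambda>i. if i \<in> E then \<Sum>j\<in>E. C i j * v j else 0, v) =
      (\<lambda>i. if i \<in> E then \<Sum>j\<in>E. (C i j + (if i = e \<and> j = e then 1 else 0)) * v j else 0, v)" for v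
  proof -
    have "(\<Sum>j\<in>E. (C i j + (if i = e \<and> j = e then 1 else 0)) * v j) =
        (\<Sum>j\<in>E. C i j * v j) + (\<Sum>j\<in>E. if j = e then (if i = e then v e else 0) else 0)" for i
      unfolding sum.distrib[symmetric] by (intro sum.cong) (auto simp: distrib_right)
    then show ?thesis using assms by (simp add: shear_on_def fun_eq_iff)
  qed
  then show ?thesis unfolding graph_space_def image_image by simp
qed

text \<open>The shear at \<open>e\<close> flips the diagonal entry \<open>C e e\<close>.\<close>

lemma singleton_shear_graph_space:
  assumes L: "lagrangian E L" and empty: "{} \<in> transversal_family E L" and e: "e \<in> E"
  shows "{e} \<in> transversal_family E (shear_on {e} ` L) \<longleftrightarrow> {e} \<notin> transversal_family E L"
proof -
  have fin: "finite E" using L by (simp add: lagrangian_def)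
  obtain C where C: "\<And>i j. C i j = C j i" "L = graph_space E C"
    by (rule lagrangian_eq_graph_space[OF L empty]) (rule that)
  have e': "{e} \<subseteq> E" using e by simp
  show ?thesis
    unfolding C(2) shear_on_graph_space[OF fin e] transversal_family_graph_space[OF fin e'] nonsing_singleton
    by (cases "C e e") auto
qed

text \<open>The shear turns the condition at \<open>e\<close> into \<open>u e = v e\<close>, which is not affected by exchanging \<open>u\<close> and
  \<open>v\<close> at \<open>e\<close>.\<close>

lemma transversal_family_shear_swap:
  assumes e: "e \<in> A" and A: "A \<subseteq> E" and B: "B = A \<or> B = A - {e}"
  shows "{e} \<in> transversal_family E (shear_on {e} ` swap_on B ` L) \<longleftrightarrow>
    A \<in> transversal_family E (shear_on {e} ` L)"
  unfolding image_image
proof (rule mem_transversal_family_cong)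
  show "{e} \<subseteq> E \<longleftrightarrow> A \<subseteq> E" using e A by blast
  fix p :: "'a bivec" and i
  have "i \<in> B \<longleftrightarrow> i \<in> A" if "i \<noteq> e" using B that by blast
  then show "coord {e} (shear_on {e} (swap_on B p)) i = coord A (shear_on {e} p) i"
    using e by (cases "i = e") (simp_all add: coord_def swap_on_def shear_on_def add.commute)
  show "fst (shear_on {e} (swap_on B p)) i = 0 \<and> snd (shear_on {e} (swap_on B p)) i = 0 \<longleftrightarrow>
      fst (shear_on {e} p) i = 0 \<and> snd (shear_on {e} p) i = 0"
    by (cases "fst p i"; cases "snd p i"; cases "i = e") (auto simp: swap_on_def shear_on_def)
qed

text \<open>This is the rule of loop complementation. With the coordinates other than \<open>e\<close> fixed, there are
  three conditions at \<open>e\<close>, namely \<open>v e = 0\<close>, \<open>u e = 0\<close> and \<open>u e = v e\<close>. The claim says that none or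
  exactly two of them cut out a complement of \<open>L\<close>. If the first or the second does, an exchange of
  components reduces this to a diagonal entry of a symmetric matrix; the remaining case follows by
  applying the same argument to the sheared space.\<close>

lemma transversal_family_shear_on:
  assumes L: "lagrangian E L" and e: "e \<in> E" and A: "A \<subseteq> E"
  shows "A \<in> transversal_family E (shear_on {e} ` L) \<longleftrightarrow>
    (A \<in> transversal_family E L) \<noteq> (e \<in> A \<and> A - {e} \<in> transversal_family E L)"
proof -
  have off: "X \<in> transversal_family E (shear_on {e} ` M) \<longleftrightarrow> X \<in> transversal_family E M"
    if "e \<notin> X" for X and M :: "'a bivec set"
  proof -
    have "X \<in> transversal_family E (shear_on {e} ` M) \<longleftrightarrow> X \<in> transversal_family E (id ` M)"
      using that by (intro mem_transversal_family_cong) (auto simp: coord_def shear_on_def)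
    then show ?thesis by simp
  qed
  show ?thesis
  proof (cases "e \<in> A")
    case False
    then show ?thesis using off by simp
  next
    case eA: True
    have sub: "A - {e} \<subseteq> E" "{e} \<subseteq> E" using A eA by auto
    have sd: "sym_diff {e} A = A - {e}" "sym_diff {e} (A - {e}) = A" using eA by auto
    have exch: "A \<in> transversal_family E (shear_on {e} ` M) \<longleftrightarrow> A \<notin> transversal_family E M"
      if M: "lagrangian E M" and m: "A - {e} \<in> transversal_family E M" for M
    proof -
      have "{} \<in> transversal_family E (swap_on (A - {e}) ` M)"
        using m transversal_family_swap_on[of "{}" E "A - {e}" M] sub by simp
      then have "{e} \<in> transversal_family E (shear_on {e} ` swap_on (A - {e}) ` M) \<longleftrightarrow>
          {e} \<notin> transversal_family E (swap_on (A - {e}) ` M)"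
        by (rule singleton_shear_graph_space[OF lagrangian_swap_on[OF M] _ e])
      then show ?thesis
        using transversal_family_shear_swap[OF eA A, of "A - {e}" M]
          transversal_family_swap_on[OF sub(2,1), of M] sd by simp
    qed
    have pres: "A \<in> transversal_family E (shear_on {e} ` M)"
      if M: "lagrangian E M" and m: "A \<in> transversal_family E M" "A - {e} \<notin> transversal_family E M" for M
    proof -
      have "{} \<in> transversal_family E (swap_on A ` M)"
        using m transversal_family_swap_on[of "{}" E A M] A by simp
      then have "{e} \<in> transversal_family E (shear_on {e} ` swap_on A ` M) \<longleftrightarrow>
          {e} \<notin> transversal_family E (swap_on A ` M)"
        by (rule singleton_shear_graph_space[OF lagrangian_swap_on[OF M] _ e])
      then show ?thesis
        using transversal_family_shear_swap[OF eA A, of A M]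
          transversal_family_swap_on[OF sub(2) A, of M] sd m by simp
    qed
    have twice: "shear_on {e} ` shear_on {e} ` L = L" by (simp add: image_image shear_on_shear_on)
    show ?thesis
    proof (cases "A - {e} \<in> transversal_family E L")
      case True
      then show ?thesis using exch[OF L] eA by simp
    next
      case False
      then have "A - {e} \<notin> transversal_family E (shear_on {e} ` L)" using off[of "A - {e}" L] by simp
      then show ?thesis
        using False pres[OF L] pres[OF lagrangian_shear_on[OF L, of "{e}"]] twice by auto
    qed
  qed
qed

section \<open>Width under twists and loop complementations\<close>

definition min_size :: "'a setsys \<Rightarrow> nat" where
  "min_size D = Min (card ` feasible D)"

lemma set_system_finite:
  assumes "set_system D"
  shows "finite (ground D)" "finite (feasible D)" "\<And>X. X \<in> feasible D \<Longrightarrow> X \<subseteq> ground D"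
    "\<And>X. X \<in> feasible D \<Longrightarrow> finite X"
proof -
  show fin: "finite (ground D)" and sub: "\<And>X. X \<in> feasible D \<Longrightarrow> X \<subseteq> ground D"
    using assms by (auto simp: set_system_def)
  show "finite (feasible D)" using assms by (auto simp: set_system_def intro: finite_subset)
  show "\<And>X. X \<in> feasible D \<Longrightarrow> finite X" using sub fin by (metis finite_subset)
qed

lemma min_size_le: "set_system D \<Longrightarrow> X \<in> feasible D \<Longrightarrow> min_size D \<le> card X"
  unfolding min_size_def by (intro Min_le) (auto simp: set_system_finite)

lemma min_size_attained:
  assumes "set_system D" "proper D"
  obtains X where "X \<in> feasible D" "card X = min_size D"
proof -
  have "min_size D \<in> card ` feasible D"
    unfolding min_size_def using assms by (intro Min_in) (auto simp: set_system_finite proper_def)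
  then show thesis using that by auto
qed

lemma ground_twist: "ground (twist A D) = ground D"
  by (simp add: twist_def)

lemma feasible_twist: "feasible (twist A D) = (\<lambda>X. sym_diff X A) ` feasible D"
  by (simp add: twist_def)

lemma mem_feasible_twist: "X \<in> feasible (twist A D) \<longleftrightarrow> sym_diff X A \<in> feasible D"
  unfolding feasible_twist by (rule mem_twist)

lemma setsys_eqI:
  "ground D = ground D' \<Longrightarrow> (\<And>X. X \<in> feasible D \<longleftrightarrow> X \<in> feasible D') \<Longrightarrow> D = D'"
  by (rule prod_eqI) auto

lemma twist_twist: "twist A (twist B D) = twist (sym_diff A B) D"
proof (rule setsys_eqI)
  fix X
  have "sym_diff (sym_diff X A) B = sym_diff X (sym_diff A B)" by blast
  then show "X \<in> feasible (twist A (twist B D)) \<longleftrightarrow> X \<in> feasible (twist (sym_diff A B) D)"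
    by (simp only: mem_feasible_twist)
qed (simp add: ground_twist)

lemma twist_twist_same: "twist A (twist A D) = D"
  by (rule setsys_eqI) (auto simp: twist_twist ground_twist feasible_twist)

lemma twist_twist_compl:
  assumes "A \<subseteq> E"
  shows "twist A (twist (E - A) D) = twist E D" "twist (E - A) (twist A D) = twist E D"
    "twist E (twist A D) = twist (E - A) D" "twist A (twist E D) = twist (E - A) D"
    "twist E (twist (E - A) D) = twist A D"
proof -
  have "sym_diff A (E - A) = E" "sym_diff (E - A) A = E" "sym_diff E A = E - A"
    "sym_diff A E = E - A" "sym_diff E (E - A) = A" using assms by blast+
  then show "twist A (twist (E - A) D) = twist E D" "twist (E - A) (twist A D) = twist E D"
    "twist E (twist A D) = twist (E - A) D" "twist A (twist E D) = twist (E - A) D"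
    "twist E (twist (E - A) D) = twist A D"
    unfolding twist_twist by (simp_all only:)
qed

lemma ground_loop_compl1: "ground (loop_compl1 e D) = ground D"
  by (simp add: loop_compl1_def)

lemma ground_loop_compl: "finite A \<Longrightarrow> ground (loop_compl A D) = ground D"
  by (induction A rule: finite_induct) (simp_all add: loop_compl_empty loop_compl_insert ground_loop_compl1)

lemma loop_compl1_twist:
  assumes "e \<notin> A"
  shows "loop_compl1 e (twist A D) = twist A (loop_compl1 e D)"
proof (rule setsys_eqI)
  fix X
  have "sym_diff (X - {e}) A = sym_diff X A - {e}" "e \<in> sym_diff X A \<longleftrightarrow> e \<in> X" using assms by blast+
  then show "X \<in> feasible (loop_compl1 e (twist A D)) \<longleftrightarrow> X \<in> feasible (twist A (loop_compl1 e D))"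
    by (simp only: mem_feasible_twist mem_feasible_loop_compl1)
qed (simp add: ground_twist ground_loop_compl1)

lemma loop_compl_twist:
  "finite B \<Longrightarrow> A \<inter> B = {} \<Longrightarrow> loop_compl B (twist A D) = twist A (loop_compl B D)"
  by (induction B rule: finite_induct)
    (auto simp: loop_compl_empty loop_compl_insert loop_compl1_twist)

lemma loop_compl_Un_disjoint:
  "finite A \<Longrightarrow> finite B \<Longrightarrow> A \<inter> B = {} \<Longrightarrow> loop_compl (A \<union> B) D = loop_compl A (loop_compl B D)"
  by (induction A rule: finite_induct) (auto simp: loop_compl_empty loop_compl_insert)

lemma set_system_twist: "set_system D \<Longrightarrow> A \<subseteq> ground D \<Longrightarrow> set_system (twist A D)"
  by (auto simp: set_system_def twist_def)

lemma proper_twist: "proper D \<Longrightarrow> proper (twist A D)"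
  by (simp add: proper_def twist_def)

lemma set_system_loop_compl1:
  assumes "set_system D" "e \<in> ground D"
  shows "set_system (loop_compl1 e D)"
  using assms by (auto simp: set_system_def loop_compl1_def)

text \<open>A smallest feasible set stays feasible, and a new feasible set contains an old one.\<close>

lemma min_size_loop_compl1:
  assumes D: "set_system D" "proper D" and e: "e \<in> ground D"
  shows "proper (loop_compl1 e D)" "min_size (loop_compl1 e D) = min_size D"
proof -
  note lc = set_system_loop_compl1[OF D(1) e]
  obtain X where X: "X \<in> feasible D" "card X = min_size D"
    by (rule min_size_attained[OF D]) (rule that)
  have "X - {e} \<notin> feasible D" if "e \<in> X"
  proof
    assume "X - {e} \<in> feasible D"
    then have "min_size D \<le> card (X - {e})" by (rule min_size_le[OF D(1)])
    moreover have "card (X - {e}) < card X"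
      using set_system_finite(4)[OF D(1) X(1)] that by (rule card_Diff1_less)
    ultimately show False using X(2) by simp
  qed
  then have X': "X \<in> feasible (loop_compl1 e D)" using X(1) by (auto simp: mem_feasible_loop_compl1)
  then show p: "proper (loop_compl1 e D)" by (auto simp: proper_def)
  show "min_size (loop_compl1 e D) = min_size D"
  proof (rule antisym)
    show "min_size (loop_compl1 e D) \<le> min_size D" using min_size_le[OF lc X'] X(2) by simp
    obtain Z where Z: "Z \<in> feasible (loop_compl1 e D)" "card Z = min_size (loop_compl1 e D)"
      by (rule min_size_attained[OF lc p]) (rule that)
    have "card (Z - {e}) \<le> card Z" by (rule card_Diff1_le)
    moreover have "Z \<in> feasible D \<or> Z - {e} \<in> feasible D"
      using Z(1) by (auto simp: mem_feasible_loop_compl1)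
    ultimately show "min_size D \<le> min_size (loop_compl1 e D)"
      using min_size_le[OF D(1)] Z(2) by (metis le_trans)
  qed
qed

lemma loop_compl_proper_min_size:
  assumes D: "set_system D" "proper D" and A: "A \<subseteq> ground D"
  shows "set_system (loop_compl A D) \<and> proper (loop_compl A D) \<and>
    min_size (loop_compl A D) = min_size D"
proof -
  have "finite A" using A set_system_finite(1)[OF D(1)] by (rule finite_subset)
  then show ?thesis using A
  proof (induction A rule: finite_induct)
    case empty
    then show ?case using D by (simp add: loop_compl_empty)
  next
    case (insert e A)
    then have e: "e \<in> ground (loop_compl A D)" by (simp add: ground_loop_compl)
    show ?case
      using insert set_system_loop_compl1[OF _ e] min_size_loop_compl1[OF _ _ e]
      by (simp add: loop_compl_insert)
  qed
qed

text \<open>The full twist complements the feasible sets, so its smallest ones come from the largest ones.\<close>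

lemma width_eq:
  assumes D: "set_system D" "proper D"
  shows "width D + (min_size D + min_size (twist (ground D) D)) = card (ground D)"
proof -
  let ?E = "ground D" and ?m = "min_size (twist (ground D) D)"
  note fin = set_system_finite[OF D(1)]
  note tw = set_system_twist[OF D(1) subset_refl] proper_twist[OF D(2)]
  have compl: "card (sym_diff X ?E) = card ?E - card X" "card X \<le> card ?E" if "X \<in> feasible D" for X
  proof -
    have "sym_diff X ?E = ?E - X" using fin(3)[OF that] by blast
    then show "card (sym_diff X ?E) = card ?E - card X"
      using fin that by (simp add: card_Diff_subset)
    show "card X \<le> card ?E" using fin that by (intro card_mono)
  qed
  obtain Z where Z: "Z \<in> feasible (twist ?E D)" "card Z = ?m"
    by (rule min_size_attained[OF tw]) (rule that)
  then obtain Y where Y: "Y \<in> feasible D" "?m = card ?E - card Y"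
    using compl by (auto simp: feasible_twist)
  have "Max (card ` feasible D) = card Y"
  proof (rule Max_eqI)
    show "finite (card ` feasible D)" "card Y \<in> card ` feasible D" using fin(2) Y(1) by auto
    fix y assume "y \<in> card ` feasible D"
    then obtain X where X: "X \<in> feasible D" "y = card X" by blast
    then have "?m \<le> card ?E - card X"
      using min_size_le[OF tw(1), of "sym_diff X ?E"] compl(1)[of X] by (auto simp: feasible_twist)
    then show "y \<le> card Y" using Y compl(2)[OF X(1)] compl(2)[OF Y(1)] X(2) by linarith
  qed
  moreover have "min_size D \<le> card Y" using min_size_le[OF D(1) Y(1)] .
  ultimately show ?thesis
    using Y(2) compl(2)[OF Y(1)] by (simp add: width_def min_size_def[symmetric])
qed

lemma width_twist_ground:
  assumes "set_system D" "proper D"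
  shows "width (twist (ground D) D) = width D"
  using width_eq[OF assms] width_eq[OF set_system_twist[OF assms(1) subset_refl] proper_twist[OF assms(2)]]
  by (simp add: ground_twist twist_twist_same)

lemma dist_to_eq_min_size_twist: "dist_to (feasible D) A = min_size (twist A D)"
  by (simp add: dist_to_def min_size_def feasible_twist image_image Un_commute)

lemma width_Star:
  assumes D: "set_system D" "proper D" and A: "A \<subseteq> ground D"
  shows "width (apply_word [Star] A D) +
    (dist_to (feasible D) A + dist_to (feasible (twist (ground D) D)) A) = card (ground D)"
proof -
  show ?thesis
    using width_eq[OF set_system_twist[OF D(1) A] proper_twist[OF D(2)]]
    by (simp add: apply_word_def dist_to_eq_min_size_twist ground_twist twist_twist_compl[OF A])
qed

text \<open>Loop complementation at the elements outside of \<open>A\<close> commutes with twists and loop complementations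
  inside \<open>A\<close>. So it may be applied last, and there it leaves the minimum size unchanged. This
  replaces the loop complementation on \<open>A\<close> by one on the whole ground set; the same works for
  \<open>width_Times_Star\<close>.\<close>

lemma width_Star_Times:
  assumes D: "set_system D" "proper D" and A: "A \<subseteq> ground D"
  shows "width (apply_word [Star, Times] A D) + (dist_to (feasible D) A +
    dist_to (feasible (loop_compl (ground D) (twist (ground D) D))) A) = card (ground D)"
proof -
  let ?E = "ground D" and ?R = "ground D - A"
  have E: "?R \<union> A = ?E" and disj: "?R \<inter> A = {}" using A by auto
  have fin: "finite A" "finite ?R" using finite_subset[OF A] set_system_finite(1)[OF D(1)] by auto
  note tA = set_system_twist[OF D(1) A] proper_twist[OF D(2), of A]
  have lA: "set_system (loop_compl A (twist A D))" "proper (loop_compl A (twist A D))"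
    "min_size (loop_compl A (twist A D)) = min_size (twist A D)"
    using loop_compl_proper_min_size[OF tA] A by (auto simp: ground_twist)
  have "loop_compl A (twist ?E D) = loop_compl A (twist ?R (twist A D))"
    by (simp only: twist_twist_compl[OF A])
  also have "\<dots> = twist ?R (loop_compl A (twist A D))"
    using fin by (subst loop_compl_twist) auto
  finally have inner: "twist A (loop_compl A (twist ?E D)) = twist ?E (loop_compl A (twist A D))"
    by (simp only: twist_twist_compl[OF A])
  have "twist A (loop_compl ?E (twist ?E D)) = twist A (loop_compl ?R (loop_compl A (twist ?E D)))"
    using loop_compl_Un_disjoint[OF fin(2,1) disj, of "twist ?E D"] by (simp only: E)
  also have "\<dots> = loop_compl ?R (twist A (loop_compl A (twist ?E D)))"
    using fin by (subst loop_compl_twist) auto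
  finally have "min_size (twist A (loop_compl ?E (twist ?E D))) =
      min_size (loop_compl ?R (twist ?E (loop_compl A (twist A D))))" by (simp only: inner)
  also have "\<dots> = min_size (twist ?E (loop_compl A (twist A D)))"
    using loop_compl_proper_min_size[OF set_system_twist[OF lA(1)] proper_twist[OF lA(2)], of ?E ?R] fin
    by (simp add: ground_twist ground_loop_compl)
  finally show ?thesis
    using width_eq[OF lA(1,2)] lA(3) fin
    by (simp add: apply_word_def dist_to_eq_min_size_twist ground_twist ground_loop_compl)
qed

lemma width_Times_Star:
  assumes D: "set_system D" "proper D" and A: "A \<subseteq> ground D"
  shows "width (apply_word [Times, Star] A D) + (dist_to (feasible (loop_compl (ground D) D)) A +
    dist_to (feasible (twist (ground D) D)) A) = card (ground D)"
proof -
  let ?E = "ground D" and ?R = "ground D - A"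
  have E: "?R \<union> A = ?E" and disj: "?R \<inter> A = {}" using A by auto
  have fin: "finite A" "finite ?R" using finite_subset[OF A] set_system_finite(1)[OF D(1)] by auto
  have lA: "set_system (loop_compl A D)" "proper (loop_compl A D)"
    using loop_compl_proper_min_size[OF D A] by auto
  have tlA: "set_system (twist A (loop_compl A D))" "proper (twist A (loop_compl A D))"
    using set_system_twist[OF lA(1)] proper_twist[OF lA(2)] A fin by (auto simp: ground_loop_compl)
  have "twist A (loop_compl ?E D) = twist A (loop_compl ?R (loop_compl A D))"
    using loop_compl_Un_disjoint[OF fin(2,1) disj, of D] by (simp only: E)
  also have "\<dots> = loop_compl ?R (twist A (loop_compl A D))"
    using fin by (subst loop_compl_twist) auto
  finally have 1: "min_size (twist A (loop_compl ?E D)) = min_size (twist A (loop_compl A D))"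
    using loop_compl_proper_min_size[OF tlA, of ?R] fin by (simp add: ground_twist ground_loop_compl)
  have "twist ?E (twist A (loop_compl A D)) = twist ?R (loop_compl A D)"
    by (rule twist_twist_compl(3)[OF A])
  also have "\<dots> = loop_compl A (twist ?R D)" using fin by (subst loop_compl_twist) auto
  finally have 2: "min_size (twist ?E (twist A (loop_compl A D))) = min_size (twist ?R D)"
    using loop_compl_proper_min_size[OF set_system_twist[OF D(1)] proper_twist[OF D(2)], of ?R A] A
    by (simp add: ground_twist)
  have 3: "twist A (twist ?E D) = twist ?R D"
    by (rule twist_twist_compl(4)[OF A])
  show ?thesis
    using width_eq[OF tlA] 1 2 3 fin
    by (simp add: apply_word_def dist_to_eq_min_size_twist ground_twist ground_loop_compl)
qed

text \<open>Outside of \<open>A\<close> the right-hand side carries one twist more, and inside \<open>A\<close> one twist less: the two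
  systems differ by a twist on the whole ground set.\<close>

lemma width_Star_Times_Star:
  assumes D: "set_system D" "proper D" and A: "A \<subseteq> ground D"
  shows "width (apply_word [Star, Times, Star] A D) = width (apply_word [Times] A (twist (ground D) D))"
proof -
  let ?E = "ground D" and ?R = "ground D - A"
  have fin: "finite A" "finite ?R" using finite_subset[OF A] set_system_finite(1)[OF D(1)] by auto
  have lc: "set_system (loop_compl A (twist ?E D))" "proper (loop_compl A (twist ?E D))"
    using loop_compl_proper_min_size[OF set_system_twist[OF D(1) subset_refl] proper_twist[OF D(2)]] A
    by (auto simp: ground_twist)
  have "loop_compl A (twist ?E D) = loop_compl A (twist ?R (twist A D))"
    by (simp only: twist_twist_compl[OF A])
  also have "\<dots> = twist ?R (loop_compl A (twist A D))"
    using fin by (subst loop_compl_twist) auto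
  finally have "twist ?E (loop_compl A (twist ?E D)) = twist ?E (twist ?R (loop_compl A (twist A D)))"
    by simp
  also have "\<dots> = twist A (loop_compl A (twist A D))"
    by (rule twist_twist_compl(5)[OF A])
  finally show ?thesis
    using width_twist_ground[OF lc] fin by (simp add: apply_word_def ground_twist ground_loop_compl)
qed

text \<open>The minimum is unchanged, and a new feasible set has at most one element more than an old one.\<close>

lemma width_loop_compl1_le:
  assumes D: "set_system D" "proper D" and e: "e \<in> ground D"
  shows "width (loop_compl1 e D) \<le> width D + 1"
proof -
  note fin = set_system_finite[OF D(1)]
  note lc = set_system_loop_compl1[OF D(1) e] min_size_loop_compl1[OF D e]
  have "Max (card ` feasible (loop_compl1 e D)) \<le> Max (card ` feasible D) + 1"
  proof (rule Max.boundedI)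
    show "finite (card ` feasible (loop_compl1 e D))" using set_system_finite(2)[OF lc(1)] by simp
    show "card ` feasible (loop_compl1 e D) \<noteq> {}" using lc(2) by (simp add: proper_def)
    fix y assume "y \<in> card ` feasible (loop_compl1 e D)"
    then obtain Z where Z: "Z \<in> feasible (loop_compl1 e D)" "y = card Z" by blast
    have le: "card X \<le> Max (card ` feasible D)" if "X \<in> feasible D" for X
      using fin(2) that by simp
    have "card Z \<le> card (Z - {e}) + 1" by (auto simp: card_Diff_singleton_if)
    moreover have "Z \<in> feasible D \<or> Z - {e} \<in> feasible D"
      using Z(1) by (auto simp: mem_feasible_loop_compl1)
    ultimately show "y \<le> Max (card ` feasible D) + 1"
      using le[of Z] le[of "Z - {e}"] Z(2) by fastforce
  qed
  then show ?thesis using lc(3) unfolding width_def min_size_def by linarith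
qed

lemma loop_compl1_loop_compl1: "loop_compl1 e (loop_compl1 e D) = D"
  by (rule setsys_eqI) (auto simp: ground_loop_compl1 mem_feasible_loop_compl1)

lemma width_loop_compl1:
  assumes "set_system D" "proper D" "e \<in> ground D"
  shows "\<bar>int (width (loop_compl1 e D)) - int (width D)\<bar> \<le> 1"
  using width_loop_compl1_le[OF assms]
    width_loop_compl1_le[OF set_system_loop_compl1[OF assms(1,3)] min_size_loop_compl1(1)[OF assms], of e]
    assms(3)
  by (simp add: ground_loop_compl1 loop_compl1_loop_compl1)

lemma intermediate_value_subset:
  fixes f :: "'a set \<Rightarrow> nat"
  assumes "finite A" and step: "\<And>e B. B \<subseteq> A \<Longrightarrow> e \<in> A - B \<Longrightarrow> \<bar>int (f (insert e B)) - int (f B)\<bar> \<le> 1"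
    and "min (f {}) (f A) \<le> c" "c \<le> max (f {}) (f A)"
  shows "\<exists>B\<subseteq>A. f B = c"
  using assms
proof (induction A arbitrary: c rule: finite_induct)
  case empty
  then show ?case by auto
next
  case (insert x A)
  have s: "\<bar>int (f (insert x A)) - int (f A)\<bar> \<le> 1" using insert.prems(1)[of A x] insert.hyps by auto
  show ?case
  proof (cases "f (insert x A) = c")
    case False
    then have "min (f {}) (f A) \<le> c" "c \<le> max (f {}) (f A)"
      using s insert.prems(2,3) by linarith+
    moreover have "\<bar>int (f (insert e B)) - int (f B)\<bar> \<le> 1" if "B \<subseteq> A" "e \<in> A - B" for e B
      using that by (intro insert.prems(1)) auto
    ultimately have "\<exists>B\<subseteq>A. f B = c" by (intro insert.IH)
    then show ?thesis by blast
  qed blast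
qed

text \<open>Compare both \<open>P\<close> and \<open>Q\<close> with the empty set, adding one element at a time.\<close>

lemma width_Times_intermediate:
  assumes D: "set_system D" "proper D" and PQ: "P \<subseteq> ground D" "Q \<subseteq> ground D"
    and c: "width (apply_word [Times] P D) < c" "c < width (apply_word [Times] Q D)"
  shows "\<exists>A\<subseteq>ground D. width (apply_word [Times] A D) = c"
proof -
  define f where "f A = width (loop_compl A D)" for A
  have fin: "finite A" if "A \<subseteq> ground D" for A using that set_system_finite(1)[OF D(1)] by (rule finite_subset)
  have step: "\<bar>int (f (insert e B)) - int (f B)\<bar> \<le> 1" if "B \<subseteq> ground D" "e \<in> ground D - B" for e B
    using width_loop_compl1[of "loop_compl B D" e] loop_compl_proper_min_size[OF D that(1)] that fin[OF that(1)]
    by (simp add: f_def loop_compl_insert ground_loop_compl)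
  have ivt: "\<exists>B\<subseteq>A. f B = c" if "A \<subseteq> ground D" "min (f {}) (f A) \<le> c" "c \<le> max (f {}) (f A)" for A
    using that by (intro intermediate_value_subset fin step) auto
  have "f P < c" "c < f Q" using c by (simp_all add: f_def apply_word_def)
  then have "\<exists>A\<subseteq>ground D. f A = c"
    using ivt[OF PQ(1)] ivt[OF PQ(2)] PQ by (cases "c \<le> f {}") (auto dest: subset_trans)
  then show ?thesis by (simp add: f_def apply_word_def)
qed

section \<open>Binary delta-matroids are represented by Lagrangian spaces\<close>

definition lagrangian_setsys :: "'a setsys \<Rightarrow> bool" where
  "lagrangian_setsys D \<longleftrightarrow>
     (\<exists>L. lagrangian (ground D) L \<and> feasible D = transversal_family (ground D) L)"

lemma lagrangian_setsys_binary_family: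
  "lagrangian_setsys D \<Longrightarrow> proper D \<Longrightarrow> binary_family (ground D) (feasible D)"
  unfolding lagrangian_setsys_def proper_def using transversal_family_binary by metis

lemma lagrangian_setsys_twist:
  assumes D: "lagrangian_setsys D" and A: "A \<subseteq> ground D"
  shows "lagrangian_setsys (twist A D)"
proof -
  obtain L where L: "lagrangian (ground D) L" "feasible D = transversal_family (ground D) L"
    using D by (auto simp: lagrangian_setsys_def)
  have "X \<in> feasible (twist A D) \<longleftrightarrow> X \<in> transversal_family (ground D) (swap_on A ` L)" for X
  proof (cases "X \<subseteq> ground D")
    case True
    then show ?thesis
      using transversal_family_swap_on[OF True A, of L] L(2) by (simp add: mem_feasible_twist)
  next
    case False
    then have "\<not> sym_diff X A \<subseteq> ground D" using A by blast
    then show ?thesis using False L(2) by (auto simp: mem_feasible_twist transversal_family_def)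
  qed
  then have "feasible (twist A D) = transversal_family (ground D) (swap_on A ` L)" by blast
  then show ?thesis
    using lagrangian_swap_on[OF L(1)] unfolding lagrangian_setsys_def ground_twist by blast
qed

lemma lagrangian_setsys_loop_compl1:
  assumes D: "lagrangian_setsys D" and e: "e \<in> ground D"
  shows "lagrangian_setsys (loop_compl1 e D)"
proof -
  obtain L where L: "lagrangian (ground D) L" "feasible D = transversal_family (ground D) L"
    using D by (auto simp: lagrangian_setsys_def)
  have "X \<in> feasible (loop_compl1 e D) \<longleftrightarrow> X \<in> transversal_family (ground D) (shear_on {e} ` L)" for X
  proof (cases "X \<subseteq> ground D")
    case True
    then show ?thesis
      using transversal_family_shear_on[OF L(1) e True] L(2) by (simp add: mem_feasible_loop_compl1)
  next
    case False
    then have "\<not> X - {e} \<subseteq> ground D" using e by blast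
    then show ?thesis
      using False L(2) by (simp add: mem_feasible_loop_compl1 transversal_family_def)
  qed
  then have "feasible (loop_compl1 e D) = transversal_family (ground D) (shear_on {e} ` L)" by blast
  then show ?thesis
    using lagrangian_shear_on[OF L(1)] unfolding lagrangian_setsys_def ground_loop_compl1 by blast
qed

lemma lagrangian_setsys_loop_compl:
  assumes "lagrangian_setsys D" "finite A" "A \<subseteq> ground D"
  shows "lagrangian_setsys (loop_compl A D)"
  using assms(2,3)
proof (induction A rule: finite_induct)
  case empty
  then show ?case using assms(1) by (simp add: loop_compl_empty)
next
  case (insert e A)
  then show ?case
    using lagrangian_setsys_loop_compl1[of "loop_compl A D" e]
    by (simp add: loop_compl_insert ground_loop_compl)
qed

text \<open>The isomorphism is used to relabel the rows and columns of the matrix by the ground set, so that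
  the twist of \<open>D\<close> is the system of a graph space; twisting back keeps it Lagrangian.\<close>

lemma binary_delta_matroid_lagrangian:
  assumes "binary_delta_matroid D"
  shows "set_system D" "proper D" "lagrangian_setsys D"
proof -
  show D: "set_system D" "proper D"
    using assms by (auto simp: binary_delta_matroid_def delta_matroid_def)
  obtain A E' C where A: "A \<subseteq> ground D" and E': "finite (E' :: 'a set)" and sym: "symmetric_on E' C"
    and iso: "setsys_iso (twist A D) (matrix_setsys E' C)"
    using assms by (auto simp: binary_delta_matroid_def)
  obtain f where f: "bij_betw f (ground D) E'"
    and F: "{X. X \<subseteq> E' \<and> det_on X C \<noteq> 0} = (\<lambda>X. f ` X) ` feasible (twist A D)"
    using iso by (auto simp: setsys_iso_def matrix_setsys_def ground_twist)
  define C' where "C' i j = (if i \<in> ground D \<and> j \<in> ground D then C (f i) (f j) else 0)" for i j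
  have inj: "inj_on f (ground D)" using f by (rule bij_betw_imp_inj_on)
  have C'sym: "C' i j = C' j i" for i j
    using sym f by (auto simp: C'_def symmetric_on_def bij_betw_apply)
  have tw: "set_system (twist A D)" using D(1) A by (rule set_system_twist)
  have mem: "X \<in> feasible (twist A D) \<longleftrightarrow> nonsing C' X" if X: "X \<subseteq> ground D" for X
  proof -
    have "X \<in> feasible (twist A D) \<longleftrightarrow> f ` X \<in> (\<lambda>X. f ` X) ` feasible (twist A D)"
    proof
      assume "f ` X \<in> (\<lambda>X. f ` X) ` feasible (twist A D)"
      then obtain Y where Y: "Y \<in> feasible (twist A D)" "f ` X = f ` Y" by auto
      have "Y \<subseteq> ground D" using set_system_finite(3)[OF tw Y(1)] by (simp add: ground_twist)
      then have "X = Y" using inj_on_image_eq_iff[OF inj X] Y(2) by blast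
      then show "X \<in> feasible (twist A D)" using Y(1) by simp
    qed (rule imageI)
    also have "\<dots> \<longleftrightarrow> det_on (f ` X) C \<noteq> 0"
      unfolding F[symmetric] using X bij_betw_imp_surj_on[OF f] by auto
    also have "\<dots> \<longleftrightarrow> nonsing C (f ` X)"
      using finite_subset[OF X] set_system_finite(1)[OF D(1)] by (intro det_on_iff_nonsing) auto
    also have "\<dots> \<longleftrightarrow> nonsing C' X"
    proof (rule nonsing_reindex[symmetric])
      show "bij_betw f X (f ` X)" using inj X by (auto intro: inj_on_imp_bij_betw inj_on_subset)
    qed (use X in \<open>auto simp: C'_def\<close>)
    finally show ?thesis .
  qed
  have feas: "feasible (twist A D) = transversal_family (ground D) (graph_space (ground D) C')"
  proof (rule Set.set_eqI)
    fix X
    show "X \<in> feasible (twist A D) \<longleftrightarrow>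
        X \<in> transversal_family (ground D) (graph_space (ground D) C')"
    proof (cases "X \<subseteq> ground D")
      case True
      show ?thesis
        unfolding transversal_family_graph_space[OF set_system_finite(1)[OF D(1)] True]
        by (rule mem[OF True])
    next
      case False
      then show ?thesis
        using set_system_finite(3)[OF tw] by (auto simp: ground_twist transversal_family_def)
    qed
  qed
  have "lagrangian (ground D) (graph_space (ground D) C')"
    by (rule lagrangian_graph_space[OF set_system_finite(1)[OF D(1)]]) (rule C'sym)
  then have "lagrangian_setsys (twist A D)"
    unfolding lagrangian_setsys_def ground_twist using feas by (intro exI conjI)
  then have "lagrangian_setsys (twist A (twist A D))"
    by (rule lagrangian_setsys_twist) (simp add: ground_twist A)
  then show "lagrangian_setsys D" by (simp only: twist_twist_same)
qed

section \<open>The partial polynomials\<close>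

text \<open>The widths are complementary to sums of distances, which exchanges the roles of \<open>P\<close> and \<open>Q\<close>.\<close>

lemma complementary_no_parity_gap:
  assumes F: "binary_family E F1" "binary_family E F2"
    and width: "\<And>A. A \<subseteq> E \<Longrightarrow> f A + (dist_to F1 A + dist_to F2 A) = n"
    and PQ: "P \<subseteq> E" "Q \<subseteq> E"
    and c: "f P < c" "c < f Q" and par: "even (f P + c)" "even (f Q + c)"
  shows "\<exists>A\<subseteq>E. f A = c"
proof -
  have cn: "c \<le> n" using width[OF PQ(2)] c(2) by linarith
  have "\<exists>A\<subseteq>E. 0 + dist_to F1 A + dist_to F2 A = n - c"
  proof (rule no_parity_gap[OF F PQ(2,1)])
    show "0 + dist_to F1 Q + dist_to F2 Q < n - c" using width[OF PQ(2)] c(2) by linarith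
    show "n - c < 0 + dist_to F1 P + dist_to F2 P" using width[OF PQ(1)] c(1) cn by linarith
    show "even (0 + dist_to F1 Q + dist_to F2 Q + (n - c))"
      using width[OF PQ(2)] par(2) cn by presburger
    show "even (0 + dist_to F1 P + dist_to F2 P + (n - c))"
      using width[OF PQ(1)] par(1) cn by presburger
  qed
  then obtain A where A: "A \<subseteq> E" "dist_to F1 A + dist_to F2 A = n - c" by auto
  then have "f A = c" using width[OF A(1)] cn by linarith
  then show ?thesis using A(1) by blast
qed

lemma width_apply_word_no_parity_gap:
  assumes D: "binary_delta_matroid D"
    and w: "w \<in> {[Star], [Times], [Star, Times], [Times, Star], [Star, Times, Star]}"
    and PQ: "P \<subseteq> ground D" "Q \<subseteq> ground D"
    and c: "width (apply_word w P D) < c" "c < width (apply_word w Q D)"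
    and par: "even (width (apply_word w P D) + c)" "even (width (apply_word w Q D) + c)"
  shows "\<exists>A\<subseteq>ground D. width (apply_word w A D) = c"
proof -
  note S = binary_delta_matroid_lagrangian[OF D]
  let ?E = "ground D"
  have t: "set_system (twist ?E D)" "proper (twist ?E D)" "lagrangian_setsys (twist ?E D)"
    using set_system_twist[OF S(1)] proper_twist[OF S(2)] lagrangian_setsys_twist[OF S(3)] by blast+
  have B: "binary_family ?E (feasible D)" using lagrangian_setsys_binary_family[OF S(3,2)] .
  have Bt: "binary_family ?E (feasible (twist ?E D))"
    using lagrangian_setsys_binary_family[OF t(3,2)] by (simp add: ground_twist)
  have "binary_family (ground G) (feasible (loop_compl (ground G) G))"
    if "set_system G" "proper G" "lagrangian_setsys G" for G :: "'a setsys"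
    using lagrangian_setsys_binary_family[OF lagrangian_setsys_loop_compl[OF that(3)], of "ground G"]
      loop_compl_proper_min_size[OF that(1,2), of "ground G"] set_system_finite(1)[OF that(1)]
    by (simp add: ground_loop_compl)
  from this[OF S] this[OF t]
  have Bl: "binary_family ?E (feasible (loop_compl ?E D))"
    and Btl: "binary_family ?E (feasible (loop_compl ?E (twist ?E D)))"
    by (simp_all add: ground_twist)
  consider "w = [Star]" | "w = [Times]" | "w = [Star, Times]" | "w = [Times, Star]"
    | "w = [Star, Times, Star]" using w by blast
  then show ?thesis
  proof cases
    case 1
    show ?thesis
      by (rule complementary_no_parity_gap[OF B Bt _ PQ c par]) (simp add: 1 width_Star[OF S(1,2)])
  next
    case 2
    show ?thesis using width_Times_intermediate[OF S(1,2) PQ c[unfolded 2]] by (simp add: 2)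
  next
    case 3
    show ?thesis
      by (rule complementary_no_parity_gap[OF B Btl _ PQ c par]) (simp add: 3 width_Star_Times[OF S(1,2)])
  next
    case 4
    show ?thesis
      by (rule complementary_no_parity_gap[OF Bl Bt _ PQ c par]) (simp add: 4 width_Times_Star[OF S(1,2)])
  next
    case 5
    have eq: "width (apply_word w A D) = width (apply_word [Times] A (twist ?E D))" if "A \<subseteq> ?E" for A
      using width_Star_Times_Star[OF S(1,2) that] by (simp add: 5)
    have "\<exists>A\<subseteq>ground (twist ?E D). width (apply_word [Times] A (twist ?E D)) = c"
      using c PQ by (intro width_Times_intermediate[OF t(1,2), of P Q]) (simp_all add: eq ground_twist)
    then show ?thesis using eq by (auto simp: ground_twist)
  qed
qed

lemma coeff_partial_poly_neq_0_iff:
  assumes "finite (ground D)"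
  shows "coeff (partial_poly w D) k \<noteq> 0 \<longleftrightarrow> (\<exists>A\<subseteq>ground D. width (apply_word w A D) = k)"
proof -
  have "coeff (partial_poly w D) k =
      (\<Sum>A\<in>Pow (ground D). if width (apply_word w A D) = k then 1 else 0)"
    by (simp add: partial_poly_def coeff_sum)
  also have "\<dots> \<noteq> 0 \<longleftrightarrow> (\<exists>A\<in>Pow (ground D). width (apply_word w A D) = k)"
    using assms by (subst sum_nonneg_eq_0_iff) auto
  finally show ?thesis by auto
qed

text \<open>One statement for both halves of a polynomial: \<open>r = 0\<close> for the even and \<open>r = 1\<close> for the odd part.\<close>

lemma interpolatingI:
  fixes p q :: "int poly"
  assumes q: "\<And>n. coeff q n = coeff p (2 * n + r)" and ne: "coeff p (2 * m + r) \<noteq> 0"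
    and gap: "\<And>a b c. coeff p a \<noteq> 0 \<Longrightarrow> coeff p b \<noteq> 0 \<Longrightarrow> a < c \<Longrightarrow> c < b \<Longrightarrow>
      even (a + c) \<Longrightarrow> even (b + c) \<Longrightarrow> coeff p c \<noteq> 0"
  shows "interpolating q"
  unfolding interpolating_def
proof
  have "coeff q m \<noteq> 0" using q ne by simp
  then show "q \<noteq> 0" by auto
  show "\<nexists>k i. has_gap_at q k i"
  proof
    assume "\<exists>k i. has_gap_at q k i"
    then obtain k i where ki: "k \<ge> 1" "i \<ge> 1" "coeff q (i - 1) \<noteq> 0" "coeff q (i + k) \<noteq> 0" "coeff q i = 0"
      by (auto simp: has_gap_at_def)
    have "coeff p (2 * i + r) \<noteq> 0"
      using ki(1,2) by (intro gap[OF ki(3,4)[unfolded q]]) auto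
    then show False using ki(5) q by simp
  qed
qed

theorem theorem2:
  fixes D :: "'a setsys" and w :: "letter list"
  assumes "binary_delta_matroid D"
    and "w \<in> {[Star], [Times], [Star, Times], [Times, Star], [Star, Times, Star]}"
  shows "even_poly (partial_poly w D) \<or> odd_poly (partial_poly w D) \<or>
    (even_interpolating (partial_poly w D) \<and> odd_interpolating (partial_poly w D))"
proof -
  let ?p = "partial_poly w D"
  note fin = set_system_finite(1)[OF binary_delta_matroid_lagrangian(1)[OF assms(1)]]
  note coeff = coeff_partial_poly_neq_0_iff[OF fin, of w]
  have gap: "coeff ?p c \<noteq> 0"
    if "coeff ?p a \<noteq> 0" "coeff ?p b \<noteq> 0" "a < c" "c < b" "even (a + c)" "even (b + c)" for a b c
    using that width_apply_word_no_parity_gap[OF assms] unfolding coeff by blast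
  show ?thesis
  proof (cases "even_poly ?p \<or> odd_poly ?p")
    case False
    then obtain m n where mn: "coeff ?p m \<noteq> 0" "odd m" "coeff ?p n \<noteq> 0" "even n"
      unfolding even_poly_def odd_poly_def by blast
    obtain m' where "m = 2 * m' + 1" using mn(2) by (rule oddE)
    then have m': "coeff ?p (2 * m' + 1) \<noteq> 0" using mn(1) by simp
    obtain n' where "n = 2 * n'" using mn(4) by (rule evenE)
    then have n': "coeff ?p (2 * n' + 0) \<noteq> 0" using mn(3) by simp
    have "interpolating (odd_part ?p)"
      by (rule interpolatingI[OF coeff_odd_part m' gap])
    moreover have "interpolating (even_part ?p)"
      by (rule interpolatingI[OF _ n' gap]) (simp only: coeff_even_part add_0_right)
    ultimately show ?thesis by (simp add: even_interpolating_def odd_interpolating_def)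
  qed blast
qed

end
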